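(* Let $\Omega$ be a domain on $\mathbb{S}^2$ with $|\Omega|<|\mathbb{S}^2|=4\pi$. Let $N\ge1$ and let $\{\psi_j\}_{j=1}^N\subset H^1_0(\Omega)$ be a family of real-valued scalar functions that is orthonormal in $L_2(\Omega)$. Then $\rho(s):=\sum_{j=1}^N\psi_j(s)^2$ satisfies the inequality $$ \int_{\Omega}\rho(s)^2\,dS\le k(\Omega)\sum_{j=1}^N\|\nabla\psi_j\|^2_{L^2(\Omega)}, $$ where the constant $k(\Omega)$ (depending only on $\Omega$, not on $N$ or on the family) satisfies $$ k(\Omega)\le\frac{2}{\pi}\,\frac{4\pi+|\Omega|}{4\pi-|\Omega|}. $$
   Context: $\mathbb{S}^2$ is the unit two-dimensional sphere with its standard round metric and surface measure $dS$; $|\Omega|$ denotes the surface area of $\Omega$. $\nabla$ is the Riemannian gradient on $\mathbb{S}^2$. $H^1_0(\Omega)$ is the standard Sobolev space of functions on $\Omega$ vanishing on the boundary (the closure of $C_0^\infty(\Omega)$ in the $H^1$ norm). Here $k(\Omega)$ denotes the best (smallest) constant for which the inequality holds for all such orthonormal families and all $N$. *)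

theory Defs
  imports "HOL-Analysis.Analysis"
begin

section \<open>The unit sphere and its surface measure\<close>

abbreviation S2 :: "(real^3) set" where
  "S2 \<equiv> sphere 0 1"

text \<open>
  In polar coordinates on \<open>\<real>\<^sup>3\<close> the Lebesgue measure is \<open>r\<^sup>2 dr dS\<close>, so the part of the unit ball
  lying on the rays through a Borel set \<open>A \<subseteq> S2\<close> has volume \<open>|A| \<cdot> \<integral>\<^sub>0\<^sup>1 r\<^sup>2 dr = |A| / 3\<close>.
  The surface measure is therefore three times the image of the Lebesgue measure of the
  punctured ball under the radial projection.
\<close>

definition surface_measure :: "(real^3) measure" where
  "surface_measure =
     scale_measure 3 (distr (restrict_space lborel (cball 0 1 - {0})) (restrict_space borel S2)
       (\<lambda>x. x /\<^sub>R norm x))"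

abbreviation surface_on :: "(real^3) set \<Rightarrow> (real^3) measure" where
  "surface_on \<Omega> \<equiv> restrict_space surface_measure \<Omega>"

lemma space_surface_measure [simp]: "space surface_measure = S2"
  and sets_surface_measure [simp]: "sets surface_measure = sets (restrict_space borel S2)"
  by (simp_all add: surface_measure_def space_restrict_space space_scale_measure)

lemma emeasure_surface_measure:
  assumes "A \<in> sets (restrict_space borel S2)"
  shows "emeasure surface_measure A =
           3 * emeasure lborel {x \<in> cball 0 1 - {0}. x /\<^sub>R norm x \<in> A}"
proof -
  let ?B = "cball 0 1 - {0} :: (real^3) set"
  have B: "?B \<in> sets lborel" by simp
  have "(\<lambda>x. x /\<^sub>R norm x) \<in> borel_measurable (restrict_space lborel ?B)"
    by (rule measurable_restrict_space1) measurable
  moreover have "(\<lambda>x. x /\<^sub>R norm x) \<in> space (restrict_space lborel ?B) \<rightarrow> S2"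
    by (auto simp: space_restrict_space)
  ultimately have meas: "(\<lambda>x. x /\<^sub>R norm x)
      \<in> measurable (restrict_space lborel ?B) (restrict_space borel S2)"
    by (rule measurable_restrict_space2[rotated])
  have "(\<lambda>x. x /\<^sub>R norm x) -` A \<inter> space (restrict_space lborel ?B)
          = {x \<in> ?B. x /\<^sub>R norm x \<in> A}"
    by (auto simp: space_restrict_space)
  then show ?thesis
    using assms meas B unfolding surface_measure_def
    by (simp add: emeasure_distr emeasure_restrict_space subset_eq)
qed

lemma measure_surface_S2: "measure surface_measure S2 = 4 * pi"
proof -
  have eq: "{x \<in> cball 0 1 - {0}. x /\<^sub>R norm x \<in> S2} = (cball 0 1 - {0} :: (real^3) set)"
    by auto
  have top: "S2 \<in> sets (restrict_space borel S2)"
    using sets.top[of "restrict_space borel S2"] by (simp add: space_restrict_space)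
  have "emeasure lborel (cball 0 1 - {0} :: (real^3) set) = emeasure lborel (cball 0 1 :: (real^3) set)"
    by (intro emeasure_Diff_null_set) (auto simp: null_sets_def)
  also have "\<dots> = ennreal (4 / 3 * pi)"
    by (simp add: emeasure_cball unit_ball_vol_3)
  finally have "emeasure surface_measure S2 = 3 * ennreal (4 / 3 * pi)"
    by (simp only: emeasure_surface_measure[OF top] eq)
  also have "\<dots> = ennreal (4 * pi)"
    by (simp flip: ennreal_numeral add: ennreal_mult''[symmetric])
  finally show ?thesis by (simp add: measure_def)
qed

definition sphere_domain :: "(real^3) set \<Rightarrow> bool" where
  "sphere_domain \<Omega> \<longleftrightarrow> openin (top_of_set S2) \<Omega> \<and> connected \<Omega> \<and> \<Omega> \<noteq> {}"


section \<open>Differential operators on the sphere\<close>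

text \<open>
  The derivative is taken within \<open>S2\<close>, so only the values of \<open>f\<close> on the sphere matter. It determines
  a representing vector only up to multiples of the normal \<open>s\<close>; the Riemannian gradient is the
  tangential one.
\<close>

definition has_sphere_grad :: "(real^3 \<Rightarrow> real) \<Rightarrow> real^3 \<Rightarrow> real^3 \<Rightarrow> bool" where
  "has_sphere_grad f g s \<longleftrightarrow> g \<bullet> s = 0 \<and> (f has_derivative (\<lambda>h. g \<bullet> h)) (at s within S2)"

definition sphere_grad :: "(real^3 \<Rightarrow> real) \<Rightarrow> real^3 \<Rightarrow> real^3" where
  "sphere_grad f s = (THE g. has_sphere_grad f g s)"

lemma has_sphere_grad_unique:
  assumes s: "s \<in> S2" and g: "has_sphere_grad f g s" and g': "has_sphere_grad f g' s"
  shows "g = g'"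
proof (rule ccontr)
  assume "g \<noteq> g'"
  define d where "d = g - g'"
  define u where "u = d /\<^sub>R norm d"
  have d: "d \<noteq> 0" using \<open>g \<noteq> g'\<close> by (simp add: d_def)
  have us: "u \<bullet> s = 0" "u \<bullet> u = 1" "s \<bullet> s = 1"
    using g g' s d
    by (auto simp: has_sphere_grad_def u_def d_def inner_diff_left dot_square_norm power2_eq_square)
  define c where "c = (\<lambda>t::real. cos t *\<^sub>R s + sin t *\<^sub>R u)"
  have c_in: "c t \<in> S2" for t
  proof -
    have "c t \<bullet> c t = (cos t)\<^sup>2 + (sin t)\<^sup>2"
      using us by (simp add: c_def inner_add_left inner_add_right inner_commute power2_eq_square)
    then show ?thesis by (simp add: norm_eq_sqrt_inner)
  qed
  have dc: "(c has_derivative (\<lambda>t. t *\<^sub>R u)) (at 0)"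
    unfolding c_def by (auto intro!: derivative_eq_intros)
  have c0: "c 0 = s" by (simp add: c_def)
  have *: "((\<lambda>t. f (c t)) has_derivative (\<lambda>t. k \<bullet> (t *\<^sub>R u))) (at 0)"
    if "has_sphere_grad f k s" for k
  proof -
    have "(f has_derivative (\<lambda>h. k \<bullet> h)) (at (c 0) within range c)"
      using that c_in c0 unfolding has_sphere_grad_def
      by (metis has_derivative_subset image_subsetI)
    from diff_chain_within[OF dc this] show ?thesis by (simp add: o_def)
  qed
  have "(\<lambda>t. g \<bullet> (t *\<^sub>R u)) = (\<lambda>t::real. g' \<bullet> (t *\<^sub>R u))"
    by (rule has_derivative_unique[OF *[OF g] *[OF g']])
  from fun_cong[OF this, of 1] have "d \<bullet> u = 0" by (simp add: d_def inner_diff_left)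
  then show False using d by (simp add: u_def)
qed

text \<open>For a tangent field, the Riemannian divergence is the trace of the tangential derivative.\<close>

definition sphere_div :: "(real^3 \<Rightarrow> real^3) \<Rightarrow> real^3 \<Rightarrow> real" where
  "sphere_div X s = (\<Sum>i\<in>UNIV. sphere_grad (\<lambda>y. X y $ i) s $ i)"

primrec Ck_on :: "nat \<Rightarrow> 'a::real_normed_vector set \<Rightarrow> ('a \<Rightarrow> 'b::real_normed_vector) \<Rightarrow> bool" where
  "Ck_on 0 U F \<longleftrightarrow> continuous_on U F"
| "Ck_on (Suc k) U F \<longleftrightarrow>
     (\<forall>x\<in>U. F differentiable (at x)) \<and> (\<forall>v. Ck_on k U (\<lambda>x. frechet_derivative F (at x) v))"

text \<open>Smoothness on the submanifold \<open>S2\<close>: having a smooth extension to a neighbourhood.\<close>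

definition smooth_on_S2 :: "(real^3 \<Rightarrow> 'b::real_normed_vector) \<Rightarrow> bool" where
  "smooth_on_S2 f \<longleftrightarrow>
     (\<exists>U F. open U \<and> S2 \<subseteq> U \<and> (\<forall>k. Ck_on k U F) \<and> (\<forall>s\<in>S2. F s = f s))"

text \<open>\<open>C\<^sub>0\<^sup>\<infinity>(\<Omega>)\<close>, for scalar functions as well as for vector fields; extension by zero to \<open>S2\<close> is built in.\<close>

definition test_functions :: "(real^3) set \<Rightarrow> (real^3 \<Rightarrow> 'b::real_normed_vector) set" where
  "test_functions \<Omega> =
     {f. smooth_on_S2 f \<and> (\<exists>K. compact K \<and> K \<subseteq> \<Omega> \<and> (\<forall>s\<in>S2 - K. f s = 0))}"


section \<open>Sobolev spaces\<close>

definition L2_sq :: "(real^3) set \<Rightarrow> (real^3 \<Rightarrow> 'b::real_normed_vector) \<Rightarrow> ennreal" where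
  "L2_sq \<Omega> f = (\<integral>\<^sup>+ s. ennreal ((norm (f s))\<^sup>2) \<partial>surface_on \<Omega>)"

definition L2 :: "(real^3) set \<Rightarrow> (real^3 \<Rightarrow> 'b::real_normed_vector) set" where
  "L2 \<Omega> = {f. f \<in> borel_measurable (surface_on \<Omega>) \<and> L2_sq \<Omega> f < \<infinity>}"

definition has_weak_grad ::
    "(real^3) set \<Rightarrow> (real^3 \<Rightarrow> real) \<Rightarrow> (real^3 \<Rightarrow> real^3) \<Rightarrow> bool" where
  "has_weak_grad \<Omega> f G \<longleftrightarrow>
     (AE s in surface_on \<Omega>. G s \<bullet> s = 0) \<and>
     (\<forall>X \<in> test_functions \<Omega>. (\<forall>s\<in>S2. X s \<bullet> s = 0) \<longrightarrow>
        (\<integral>s. f s * sphere_div X s \<partial>surface_on \<Omega>) = - (\<integral>s. G s \<bullet> X s \<partial>surface_on \<Omega>))"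

definition H1 :: "(real^3) set \<Rightarrow> (real^3 \<Rightarrow> real) set" where
  "H1 \<Omega> = {f \<in> L2 \<Omega>. \<exists>G \<in> L2 \<Omega>. has_weak_grad \<Omega> f G}"

text \<open>The weak gradient is unique only up to null sets; \<open>weak_grad\<close> picks a representative.\<close>

definition weak_grad :: "(real^3) set \<Rightarrow> (real^3 \<Rightarrow> real) \<Rightarrow> real^3 \<Rightarrow> real^3" where
  "weak_grad \<Omega> f = (SOME G. G \<in> L2 \<Omega> \<and> has_weak_grad \<Omega> f G)"

text \<open>
  The closure of \<open>C\<^sub>0\<^sup>\<infinity>(\<Omega>)\<close> in \<open>H\<^sup>1(\<Omega>)\<close>. The weak gradient of a test function being its classical
  gradient, \<open>L2_sq \<Omega> (f - \<phi>) + L2_sq \<Omega> (weak_grad \<Omega> f - sphere_grad \<phi>)\<close> is the squared \<open>H\<^sup>1\<close> distance.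
\<close>

definition H1_0 :: "(real^3) set \<Rightarrow> (real^3 \<Rightarrow> real) set" where
  "H1_0 \<Omega> = {f \<in> H1 \<Omega>. \<forall>\<epsilon>>0. \<exists>\<phi> \<in> test_functions \<Omega>.
      L2_sq \<Omega> (\<lambda>s. f s - \<phi> s) + L2_sq \<Omega> (\<lambda>s. weak_grad \<Omega> f s - sphere_grad \<phi> s) < \<epsilon>}"


section \<open>Orthonormal families and the best constant\<close>

definition orthonormal_family :: "(real^3) set \<Rightarrow> nat \<Rightarrow> (nat \<Rightarrow> real^3 \<Rightarrow> real) \<Rightarrow> bool" where
  "orthonormal_family \<Omega> N \<psi> \<longleftrightarrow>
     (\<forall>i\<in>{1..N}. \<forall>j\<in>{1..N}. (\<integral>s. \<psi> i s * \<psi> j s \<partial>surface_on \<Omega>) = (if i = j then 1 else 0))"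

definition rho :: "nat \<Rightarrow> (nat \<Rightarrow> real^3 \<Rightarrow> real) \<Rightarrow> real^3 \<Rightarrow> real" where
  "rho N \<psi> s = (\<Sum>j=1..N. (\<psi> j s)\<^sup>2)"

text \<open>
  Both sides are valued in \<open>[0, \<infinity>]\<close>; for a finite constant the inequality includes
  the finiteness of the left-hand side.
\<close>

definition admissible_constant :: "(real^3) set \<Rightarrow> ennreal \<Rightarrow> bool" where
  "admissible_constant \<Omega> k \<longleftrightarrow>
     (\<forall>N\<ge>1. \<forall>\<psi>. (\<forall>j\<in>{1..N}. \<psi> j \<in> H1_0 \<Omega>) \<and> orthonormal_family \<Omega> N \<psi> \<longrightarrow>
        (\<integral>\<^sup>+ s. ennreal ((rho N \<psi> s)\<^sup>2) \<partial>surface_on \<Omega>)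
          \<le> k * (\<Sum>j=1..N. L2_sq \<Omega> (weak_grad \<Omega> (\<psi> j))))"

definition best_constant :: "(real^3) set \<Rightarrow> ennreal" where
  "best_constant \<Omega> = Inf {k. admissible_constant \<Omega> k}"

end

theory Submission
  imports Defs "HOL-Library.Discrete_Functions"
begin

text \<open>The proof works on the whole sphere, with the functions of the family extended by zero, and follows
Rumin's approach: the density is compared with the density of its low frequency part, one frequency
level after the other.

Let \<open>A\<^sub>n\<close> be the \<open>L\<^sup>2\<close> projection onto the restrictions to the sphere of the polynomials of degree less
than \<open>n\<close>, that is, onto the spherical harmonics of these degrees, and let \<open>y = \<surd>(4 \<pi> \<rho>)\<close>.

\<^item> The range of \<open>A\<^sub>n\<close> has dimension at most \<open>n\<^sup>2\<close> and is rotation invariant, so the kernel of \<open>A\<^sub>n\<close> is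
  constant on the diagonal and at most \<open>n\<^sup>2 / (4 \<pi>)\<close> there (\<open>harmonic_kernel_le\<close>). By Bessel's
  inequality for the orthonormal family, the sum of the \<open>(A\<^sub>n \<psi>\<^sub>j)\<^sup>2\<close> has the same pointwise bound.
  The triangle inequality in the space of the index \<open>j\<close> then gives
  \<open>(y - n)\<^sub>+\<^sup>2 \<le> 4 \<pi> \<Sum>\<^sub>j (\<psi>\<^sub>j - A\<^sub>n \<psi>\<^sub>j)\<^sup>2\<close> (\<open>high_degree_density_ge\<close>).

\<^item> The Laplacian has the eigenvalue \<open>- d (d + 1)\<close> on the harmonics of degree \<open>d\<close>, and
  \<open>d (d + 1)\<close> is the sum of \<open>2 n\<close> over \<open>1 \<le> n \<le> d\<close>. Hence the sum of \<open>2 n \<parallel>\<psi> - A\<^sub>n \<psi>\<parallel>\<^sup>2\<close> over \<open>n \<ge> 1\<close>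
  is at most \<open>\<parallel>\<nabla>\<psi>\<parallel>\<^sup>2\<close> (\<open>weighted_spectral_tails_le\<close>, \<open>H1_0_spectral_tails\<close>).

\<^item> The inequality \<open>y\<^sup>4 / 6 \<le> (2/3) y\<^sup>2 + \<Sum>\<^sub>n 2 n (y - n)\<^sub>+\<^sup>2\<close> for \<open>y \<ge> 0\<close> (\<open>quartic_staircase_bound\<close>)
  turns these two facts, after integration, into
  \<open>\<integral> \<rho>\<^sup>2 \<le> N / \<pi> + 3 / (2 \<pi>) \<Sum>\<^sub>j \<parallel>\<nabla>\<psi>\<^sub>j\<parallel>\<^sup>2\<close> (\<open>lieb_thirring_sphere\<close>). The term \<open>N / \<pi>\<close> stems from \<open>y\<^sup>2\<close>; some
  such term is unavoidable, since constant functions on the sphere have no energy.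

\<^item> On \<open>\<Omega>\<close> that term is absorbed. A normalised function that vanishes outside \<open>\<Omega>\<close> has at most the fraction
  \<open>|\<Omega>| / (4 \<pi>)\<close> of its mass in the constant mode (\<open>constant_mode_le\<close>), and the next eigenvalue is \<open>2\<close>, so
  \<open>\<parallel>\<nabla>\<psi>\<parallel>\<^sup>2 \<ge> 2 (1 - |\<Omega>| / (4 \<pi>))\<close>. The resulting constant \<open>2 / (4 \<pi> - |\<Omega>|) + 3 / (2 \<pi>)\<close> is at
  most the one claimed (\<open>lieb_thirring_domain\<close>).

The harmonic analysis is built from polynomials and rotations only. The gradient is represented by its
three components along the rotation fields \<open>s \<mapsto> a\<^sub>k \<times> s\<close>, for which integration by parts is the infinitesimal
form of the rotation invariance of the surface measure. The Laplacian is the sum of the squares of these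
three derivations; it maps a polynomial \<open>f\<close> of degree \<open>n\<close> to \<open>- n (n + 1) f\<close> modulo lower degrees, and
since it is symmetric, orthonormalising the monomials in the order of their degrees produces
eigenfunctions. Weak gradients enter only through their pairing with derivatives of polynomials, which is
computed by approximation with test functions (\<open>H1_0_green\<close>).\<close>

section \<open>The surface measure\<close>

lemma finite_surface_measure: "finite_measure surface_measure"
proof
  have "measure surface_measure S2 \<noteq> 0"
    by (simp add: measure_surface_S2)
  then show "emeasure surface_measure (space surface_measure) \<noteq> \<infinity>"
    by (auto simp: measure_def)
qed

interpretation surf: finite_measure surface_measure
  by (rule finite_surface_measure)

lemma surface_measurable_continuous:
  fixes f :: "real^3 \<Rightarrow> 'b::topological_space"
  assumes "continuous_on S2 f"
  shows "f \<in> borel_measurable surface_measure"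
  using borel_measurable_continuous_on_restrict[OF assms]
  by (simp cong: measurable_cong_sets)

lemma surface_integrable_continuous:
  fixes f :: "real^3 \<Rightarrow> 'b::{banach, second_countable_topology}"
  assumes "continuous_on S2 f"
  shows "integrable surface_measure f"
proof -
  have "compact (f ` S2)"
    using assms by (intro compact_continuous_image) auto
  then obtain B where "\<forall>x\<in>S2. norm (f x) \<le> B"
    by (auto dest!: compact_imp_bounded simp: bounded_iff)
  then show ?thesis
    by (intro surf.integrable_const_bound[of _ B] AE_I2 surface_measurable_continuous assms) auto
qed

lemma rotation_measurable:
  assumes "orthogonal_transformation R"
  shows "R \<in> measurable surface_measure surface_measure"
proof -
  have "R \<in> measurable (restrict_space borel S2) (restrict_space borel S2)"
  proof (rule measurable_restrict_space2)
    show "R \<in> borel_measurable (restrict_space borel S2)"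
      using assms
      by (intro borel_measurable_continuous_on_restrict linear_continuous_on
                linear_conv_bounded_linear[THEN iffD1] orthogonal_transformation_linear)
    show "R \<in> space (restrict_space borel S2) \<rightarrow> S2"
      using assms by (auto simp: orthogonal_transformation_norm)
  qed
  then show ?thesis
    by (simp cong: measurable_cong_sets)
qed

text \<open>The surface measure of \<open>A\<close> is defined by the volume of a cone over \<open>A\<close>; a rotation maps the cone over the
preimage of \<open>A\<close> onto the cone over \<open>A\<close> and preserves volume.\<close>

lemma surface_measure_rotation:
  fixes R :: "real^3 \<Rightarrow> real^3"
  assumes R: "orthogonal_transformation R"
  shows "distr surface_measure surface_measure R = surface_measure"
proof (rule measure_eqI)
  fix A assume "A \<in> sets (distr surface_measure surface_measure R)"
  then have A: "A \<in> sets (restrict_space borel S2)" by simp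
  have nR: "norm (R x) = norm x" for x
    using R by (rule orthogonal_transformation_norm)
  let ?B = "cball 0 1 - {0} :: (real^3) set"
  let ?C = "{x \<in> ?B. x /\<^sub>R norm x \<in> A}"
  let ?D = "{x \<in> ?B. x /\<^sub>R norm x \<in> R -` A \<inter> S2}"
  have pre: "R -` A \<inter> S2 \<in> sets (restrict_space borel S2)"
    using measurable_sets[OF rotation_measurable[OF R], of A] A by simp
  have cone: "{x \<in> ?B. x /\<^sub>R norm x \<in> A'} \<in> lmeasurable \<and>
      emeasure lborel {x \<in> ?B. x /\<^sub>R norm x \<in> A'} = ennreal (measure lebesgue {x \<in> ?B. x /\<^sub>R norm x \<in> A'})"
    if "A' \<in> sets (restrict_space borel S2)" for A'
  proof -
    have "A' \<in> (\<inter>) S2 ` sets borel"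
      using that by (simp add: sets_restrict_space)
    then obtain A0 where A0: "A0 \<in> sets borel" "A' = S2 \<inter> A0"
      by (elim imageE)
    have eq: "{x \<in> ?B. x /\<^sub>R norm x \<in> A'} = (\<lambda>x. x /\<^sub>R norm x) -` A0 \<inter> ?B"
      using A0 by auto
    have "(\<lambda>x::real^3. x /\<^sub>R norm x) -` A0 \<inter> space borel \<in> sets borel"
      by (rule measurable_sets[OF _ A0(1)]) measurable
    then have b: "{x \<in> ?B. x /\<^sub>R norm x \<in> A'} \<in> sets borel"
      unfolding eq by (auto intro!: sets.Int)
    moreover have bd: "bounded {x \<in> ?B. x /\<^sub>R norm x \<in> A'}"
      by (rule bounded_subset[of "cball 0 1"]) auto
    ultimately have l: "{x \<in> ?B. x /\<^sub>R norm x \<in> A'} \<in> lmeasurable"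
      by (intro bounded_set_imp_lmeasurable) auto
    then show ?thesis
      using b emeasure_eq_measure2[OF l] by (auto simp: emeasure_completion)
  qed
  have img: "R ` ?D = ?C"
  proof
    show "R ` ?D \<subseteq> ?C"
      using R nR by (auto simp: orthogonal_transformation_scaleR)
        (metis norm_eq_zero nR)+
    show "?C \<subseteq> R ` ?D"
    proof
      fix y assume y: "y \<in> ?C"
      obtain x where x: "y = R x"
        using orthogonal_transformation_surj[OF R] by (metis surjD)
      have "norm x \<noteq> 0"
        using y x nR[of x] by auto
      then have "x \<in> ?D"
        using y x nR[of x] R by (auto simp: orthogonal_transformation_scaleR)
      then show "y \<in> R ` ?D" using x by blast
    qed
  qed
  have "emeasure surface_measure (R -` A \<inter> S2) = 3 * ennreal (measure lebesgue ?D)"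
    using emeasure_surface_measure[OF pre] cone[OF pre] by simp
  also have "measure lebesgue ?D = measure lebesgue ?C"
    using measure_orthogonal_image[OF R conjunct1[OF cone[OF pre]]] by (simp only: img)
  also have "3 * ennreal (measure lebesgue ?C) = emeasure surface_measure A"
    using emeasure_surface_measure[OF A] cone[OF A] by simp
  finally show "emeasure (distr surface_measure surface_measure R) A = emeasure surface_measure A"
    using A rotation_measurable[OF R] by (simp add: emeasure_distr)
qed simp

lemma surface_integral_rotation:
  fixes f :: "real^3 \<Rightarrow> real"
  assumes R: "orthogonal_transformation R" and f: "continuous_on S2 f"
  shows "(\<integral>s. f (R s) \<partial>surface_measure) = (\<integral>s. f s \<partial>surface_measure)"
  using integral_distr[OF rotation_measurable[OF R] surface_measurable_continuous[OF f]]
  by (simp add: surface_measure_rotation[OF R])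

text \<open>Nonempty relatively open sets have positive measure because the cones over them contain nonempty open
sets. This lets identities between continuous functions be read off from \<open>L\<^sup>2\<close> identities.\<close>

lemma surface_integral_square_eq_0:
  fixes f :: "real^3 \<Rightarrow> real"
  assumes f: "continuous_on S2 f" and zero: "(\<integral>s. (f s)\<^sup>2 \<partial>surface_measure) = 0"
    and s: "s \<in> S2"
  shows "f s = 0"
proof (rule ccontr)
  assume "f s \<noteq> 0"
  have "AE x in surface_measure. (f x)\<^sup>2 = 0"
    using zero f integral_nonneg_eq_0_iff_AE[of surface_measure "\<lambda>x. (f x)\<^sup>2"]
    by (simp add: surface_integrable_continuous continuous_on_power)
  then have ae: "AE x in surface_measure. f x = 0" by simp
  define W where "W = {x \<in> S2. f x \<noteq> 0}"
  have fm: "f \<in> borel_measurable surface_measure"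
    using f by (rule surface_measurable_continuous)
  have "{x \<in> space surface_measure. f x \<noteq> 0} \<in> sets surface_measure"
    using fm by measurable
  then have Ws: "W \<in> sets surface_measure" by (simp add: W_def)
  have "emeasure surface_measure W = 0"
    using ae Ws AE_iff_measurable[of W surface_measure "\<lambda>x. f x = 0"] by (auto simp: W_def)
  obtain A0 where A0: "A0 \<in> sets borel" "W = S2 \<inter> A0"
    using Ws by (auto simp: sets_restrict_space)
  have "(\<lambda>x::real^3. x /\<^sub>R norm x) -` A0 \<inter> space borel \<in> sets borel"
    by (rule measurable_sets[OF _ A0(1)]) measurable
  moreover have "{x \<in> cball 0 1 - {0}. x /\<^sub>R norm x \<in> W}
      = (\<lambda>x. x /\<^sub>R norm x) -` A0 \<inter> (cball 0 1 - {0})"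
    using A0 by auto
  ultimately have W0: "{x \<in> cball 0 1 - {0}. x /\<^sub>R norm x \<in> W} \<in> sets lborel"
    by auto
  have nul: "emeasure lborel {x \<in> cball 0 1 - {0}. x /\<^sub>R norm x \<in> W} = 0"
    using \<open>emeasure surface_measure W = 0\<close> emeasure_surface_measure[of W] Ws by simp
  define O1 where "O1 = {x \<in> ball 0 1 - {0}. f (x /\<^sub>R norm x) \<in> - {0}}"
  have c: "continuous_on (ball 0 1 - {0}) (\<lambda>x. f (x /\<^sub>R norm x))"
  proof (rule continuous_on_compose2[OF f])
    show "continuous_on (ball 0 1 - {0}) (\<lambda>x::real^3. x /\<^sub>R norm x)"
      by (auto intro!: continuous_intros)
    show "(\<lambda>x. x /\<^sub>R norm x) ` (ball 0 1 - {0}) \<subseteq> S2"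
    proof (intro image_subsetI)
      fix x :: "real^3" assume "x \<in> ball 0 1 - {0}"
      then have "norm x \<noteq> 0" by simp
      then show "x /\<^sub>R norm x \<in> S2" by simp
    qed
  qed
  have O: "open O1"
  proof -
    have "open ((\<lambda>x. f (x /\<^sub>R norm x)) -` (- {0}) \<inter> (ball 0 1 - {0}))"
      using continuous_on_open_vimage[of "ball 0 1 - {0}" "\<lambda>x. f (x /\<^sub>R norm x)"] c by auto
    moreover have "O1 = (\<lambda>x. f (x /\<^sub>R norm x)) -` (- {0}) \<inter> (ball 0 1 - {0})"
      by (auto simp: O1_def)
    ultimately show ?thesis by simp
  qed
  have "s /\<^sub>R 2 \<in> O1"
    using s \<open>f s \<noteq> 0\<close> by (auto simp: O1_def)
  then have "\<not> negligible O1"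
    using O open_not_negligible by blast
  moreover have "O1 \<subseteq> {x \<in> cball 0 1 - {0}. x /\<^sub>R norm x \<in> W}"
  proof
    fix x assume x: "x \<in> O1"
    then have "norm x \<noteq> 0" by (simp add: O1_def)
    then show "x \<in> {x \<in> cball 0 1 - {0}. x /\<^sub>R norm x \<in> W}"
      using x by (simp add: O1_def W_def)
  qed
  then have "emeasure lborel O1 = 0"
    using nul W0 emeasure_mono[of O1 "{x \<in> cball 0 1 - {0}. x /\<^sub>R norm x \<in> W}" lborel] by simp
  then have "O1 \<in> null_sets lborel"
    using O by (intro null_setsI) auto
  then have "O1 \<in> null_sets lebesgue"
    by (rule null_sets_completionI)
  then have "negligible O1" by (simp add: negligible_iff_null_sets)
  ultimately show False by simp
qed

section \<open>Rotations and angular derivatives\<close>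

text \<open>For a unit vector \<open>a\<close> this is Rodrigues' formula for the rotation about \<open>a\<close> by the angle \<open>t\<close>.\<close>

definition rot :: "real^3 \<Rightarrow> real \<Rightarrow> real^3 \<Rightarrow> real^3" where
  "rot a t x = (a \<bullet> x) *\<^sub>R a + cos t *\<^sub>R (x - (a \<bullet> x) *\<^sub>R a) + sin t *\<^sub>R cross3 a x"

lemma rot_0 [simp]: "rot a 0 x = x"
  by (simp add: rot_def)

lemma orthogonal_transformation_rot:
  assumes a: "norm a = 1"
  shows "orthogonal_transformation (rot a t)"
  unfolding orthogonal_transformation
proof (intro conjI allI)
  show "linear (rot a t)"
    by (rule linearI)
      (simp_all add: rot_def inner_add_right cross_add_right cross_mult_right algebra_simps)
  fix x
  define y where "y = x - (a \<bullet> x) *\<^sub>R a"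
  have aa: "a \<bullet> a = 1" using a by (simp add: dot_square_norm)
  have ay: "a \<bullet> y = 0" by (simp add: y_def inner_diff_right aa)
  have ac: "a \<bullet> cross3 a x = 0" "cross3 a x \<bullet> a = 0" "x \<bullet> cross3 a x = 0" "cross3 a x \<bullet> x = 0"
    by (simp_all add: dot_cross_self inner_commute)
  have yc: "y \<bullet> cross3 a x = 0" by (simp add: y_def inner_diff_left ac)
  have yy: "y \<bullet> y = x \<bullet> x - (a \<bullet> x)\<^sup>2"
    by (simp add: y_def inner_diff_left inner_diff_right aa inner_commute power2_eq_square)
  have cc: "cross3 a x \<bullet> cross3 a x = x \<bullet> x - (a \<bullet> x)\<^sup>2"
    by (simp add: dot_cross aa power2_eq_square inner_commute)
  have "rot a t x \<bullet> rot a t x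
      = (a \<bullet> x)\<^sup>2 + (cos t)\<^sup>2 * (y \<bullet> y) + (sin t)\<^sup>2 * (cross3 a x \<bullet> cross3 a x)"
    using ay yc ac aa unfolding rot_def y_def[symmetric]
    by (simp add: inner_add_left inner_add_right inner_commute power2_eq_square algebra_simps)
  also have "\<dots> = (a \<bullet> x)\<^sup>2 + ((cos t)\<^sup>2 + (sin t)\<^sup>2) * (x \<bullet> x - (a \<bullet> x)\<^sup>2)"
    unfolding yy cc by (simp only: distrib_right)
  also have "\<dots> = x \<bullet> x" by simp
  finally show "norm (rot a t x) = norm x" by (simp add: norm_eq_sqrt_inner)
qed

lemma rot_has_vector_derivative:
  assumes a: "norm a = 1"
  shows "((\<lambda>t. rot a t x) has_vector_derivative cross3 a (rot a t x)) (at t)"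
proof -
  have aa: "a \<bullet> a = 1" using a by (simp add: dot_square_norm)
  have "((\<lambda>t. rot a t x) has_vector_derivative
      (- sin t *\<^sub>R (x - (a \<bullet> x) *\<^sub>R a) + cos t *\<^sub>R cross3 a x)) (at t)"
    unfolding rot_def has_vector_derivative_def
    by (auto intro!: derivative_eq_intros simp: algebra_simps)
  moreover have "cross3 a (rot a t x)
      = - sin t *\<^sub>R (x - (a \<bullet> x) *\<^sub>R a) + cos t *\<^sub>R cross3 a x"
    by (simp add: rot_def cross_add_right Cross3.right_diff_distrib cross_mult_right Lagrange aa
        algebra_simps)
  ultimately show ?thesis by simp
qed

text \<open>The derivative along the velocity field of the rotations about \<open>a\<close>. On the sphere this field is tangent,
and the three fields belonging to an orthonormal basis carry the full information about the gradient.\<close>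

definition angular :: "real^3 \<Rightarrow> (real^3 \<Rightarrow> real) \<Rightarrow> real^3 \<Rightarrow> real" where
  "angular a f x = frechet_derivative f (at x) (cross3 a x)"

definition C1_on_S2 :: "(real^3 \<Rightarrow> real) \<Rightarrow> bool" where
  "C1_on_S2 f \<longleftrightarrow> (\<forall>x\<in>S2. f differentiable (at x)) \<and>
     (\<forall>v. continuous_on S2 (\<lambda>x. frechet_derivative f (at x) v))"

lemma C1_on_S2_continuous: "C1_on_S2 f \<Longrightarrow> continuous_on S2 f"
  unfolding C1_on_S2_def
  by (meson continuous_at_imp_continuous_on differentiable_imp_continuous_within)

lemma angular_eq:
  assumes "(f has_derivative f') (at x)"
  shows "angular a f x = f' (cross3 a x)"
  using frechet_derivative_at[OF assms] by (simp add: angular_def)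

lemma continuous_on_cross3: "continuous_on S (cross3 a)"
  by (intro linear_continuous_on linear_conv_bounded_linear[THEN iffD1] linearI)
    (simp_all add: cross_add_right cross_mult_right)

lemma C1_on_S2_angular_continuous:
  assumes "C1_on_S2 f"
  shows "continuous_on S2 (angular a f)"
proof -
  have eq: "angular a f x = (\<Sum>i\<in>UNIV. cross3 a x $ i * frechet_derivative f (at x) (axis i 1))"
    if "x \<in> S2" for x
  proof -
    have "linear (frechet_derivative f (at x))"
      using assms that by (intro linear_frechet_derivative) (auto simp: C1_on_S2_def)
    from linear_sum[OF this, of "\<lambda>i. cross3 a x $ i *\<^sub>R axis i 1" UNIV]
    have "frechet_derivative f (at x) (\<Sum>i\<in>UNIV. cross3 a x $ i *\<^sub>R axis i 1) =
        (\<Sum>i\<in>UNIV. cross3 a x $ i * frechet_derivative f (at x) (axis i 1))"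
      using \<open>linear (frechet_derivative f (at x))\<close> by (simp add: linear_cmul)
    then show ?thesis
      using basis_expansion[of "cross3 a x"]
      by (simp add: angular_def scalar_mult_eq_scaleR)
  qed
  have "continuous_on S2
      (\<lambda>x. \<Sum>i\<in>UNIV. cross3 a x $ i * frechet_derivative f (at x) (axis i 1))"
    using assms unfolding C1_on_S2_def by (intro continuous_intros continuous_on_cross3) auto
  then show ?thesis
    using eq continuous_on_cong[of S2 S2 "angular a f"] by simp
qed

lemma C1_on_S2_mult:
  assumes f: "C1_on_S2 f" and g: "C1_on_S2 g"
  shows "C1_on_S2 (\<lambda>x. f x * g x)"
proof -
  have fd: "f differentiable (at x)" and gd: "g differentiable (at x)" if "x \<in> S2" for x
    using f g that by (auto simp: C1_on_S2_def)
  have "frechet_derivative (\<lambda>x. f x * g x) (at x) v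
      = f x * frechet_derivative g (at x) v + frechet_derivative f (at x) v * g x" if "x \<in> S2" for x v
    using has_derivative_mult[OF fd[OF that, unfolded frechet_derivative_works]
        gd[OF that, unfolded frechet_derivative_works]]
    by (metis (no_types, lifting) frechet_derivative_at)
  moreover have "continuous_on S2
      (\<lambda>x. f x * frechet_derivative g (at x) v + frechet_derivative f (at x) v * g x)" for v
    using f g C1_on_S2_continuous[OF f] C1_on_S2_continuous[OF g]
    unfolding C1_on_S2_def by (intro continuous_intros) auto
  ultimately have "continuous_on S2 (\<lambda>x. frechet_derivative (\<lambda>x. f x * g x) (at x) v)" for v
    using continuous_on_cong[of S2 S2 "\<lambda>x. frechet_derivative (\<lambda>x. f x * g x) (at x) v"] by simp
  then show ?thesis
    using fd gd unfolding C1_on_S2_def by (auto intro!: differentiable_mult)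
qed

lemma angular_mult:
  assumes "f differentiable (at x)" "g differentiable (at x)"
  shows "angular a (\<lambda>x. f x * g x) x = f x * angular a g x + angular a f x * g x"
  using angular_eq[OF has_derivative_mult[OF assms[unfolded frechet_derivative_works]]]
  by (simp add: angular_def)

lemma angular_rot_derivative:
  assumes a: "norm a = 1" and f: "C1_on_S2 f" and s: "s \<in> S2"
  shows "((\<lambda>t. f (rot a t s)) has_real_derivative angular a f (rot a t s)) (at t)"
proof -
  have "rot a t s \<in> S2"
    using orthogonal_transformation_norm[OF orthogonal_transformation_rot[OF a], of t s] s by simp
  then have "(f has_derivative frechet_derivative f (at (rot a t s))) (at (rot a t s))"
    using f by (simp add: C1_on_S2_def frechet_derivative_works)
  from has_derivative_compose[OF rot_has_vector_derivative[OF a, unfolded has_vector_derivative_def] this]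
  have *: "((\<lambda>t. f (rot a t s)) has_derivative
      (\<lambda>h. frechet_derivative f (at (rot a t s)) (h *\<^sub>R cross3 a (rot a t s)))) (at t)" .
  have "linear (frechet_derivative f (at (rot a t s)))"
    using f \<open>rot a t s \<in> S2\<close> by (intro linear_frechet_derivative) (auto simp: C1_on_S2_def)
  then have "(\<lambda>h. frechet_derivative f (at (rot a t s)) (h *\<^sub>R cross3 a (rot a t s)))
      = (*) (angular a f (rot a t s))"
    by (auto simp: angular_def linear_cmul)
  with * show ?thesis by (simp add: has_field_derivative_def)
qed

text \<open>The angular derivative is the limit of the difference quotients of \<open>f\<close> along the rotations about \<open>a\<close>. Each
quotient integrates to zero by rotation invariance, and the mean value theorem bounds all of them by
the maximum of the angular derivative, so the limit may be taken under the integral.\<close>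

lemma integral_angular:
  assumes a: "norm a = 1" and f: "C1_on_S2 f"
  shows "(\<integral>s. angular a f s \<partial>surface_measure) = 0"
proof -
  have cf: "continuous_on S2 f" and ca: "continuous_on S2 (angular a f)"
    using C1_on_S2_continuous[OF f] C1_on_S2_angular_continuous[OF f] by auto
  have "compact (angular a f ` S2)"
    using ca by (intro compact_continuous_image) auto
  then have "\<exists>B. \<forall>x\<in>S2. \<bar>angular a f x\<bar> \<le> B"
    by (auto dest!: compact_imp_bounded simp: bounded_iff)
  then obtain B where B: "\<And>x. x \<in> S2 \<Longrightarrow> \<bar>angular a f x\<bar> \<le> B"
    by blast
  have rS: "rot a t s \<in> S2" if "s \<in> S2" for t s
    using orthogonal_transformation_norm[OF orthogonal_transformation_rot[OF a], of t s] that by simp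
  define h where "h n = inverse (real (Suc n))" for n
  define q where "q n s = (f (rot a (h n) s) - f s) / h n" for n s
  have crot: "continuous_on S2 (\<lambda>s. f (rot a t s))" for t
  proof (rule continuous_on_compose2[OF cf])
    show "continuous_on S2 (rot a t)"
      using orthogonal_transformation_linear[OF orthogonal_transformation_rot[OF a]]
      by (simp add: linear_continuous_on linear_conv_bounded_linear)
  qed (use rS in blast)
  have zero: "(\<integral>s. q n s \<partial>surface_measure) = 0" for n
    using surface_integral_rotation[OF orthogonal_transformation_rot[OF a] cf, of "h n"]
      surface_integrable_continuous[OF crot] surface_integrable_continuous[OF cf]
    by (simp add: q_def)
  have bound: "\<bar>q n s\<bar> \<le> B" if s: "s \<in> S2" for n s
  proof -
    have "h n > 0" by (simp add: h_def)
    then obtain z where "f (rot a (h n) s) - f (rot a 0 s) = (h n - 0) * angular a f (rot a z s)"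
      using MVT2[of 0 "h n" "\<lambda>t. f (rot a t s)" "\<lambda>t. angular a f (rot a t s)"]
        angular_rot_derivative[OF a f s] by blast
    then have "q n s = angular a f (rot a z s)"
      using \<open>h n > 0\<close> by (simp add: q_def)
    then show ?thesis using B rS s by simp
  qed
  have lim: "(\<lambda>n. q n s) \<longlonglongrightarrow> angular a f s" if s: "s \<in> S2" for s
  proof -
    have "((\<lambda>t. (f (rot a t s) - f (rot a 0 s)) / (t - 0)) \<longlongrightarrow> angular a f (rot a 0 s)) (at 0)"
      using angular_rot_derivative[OF a f s, of 0] by (simp only: has_field_derivative_iff)
    then have *: "((\<lambda>t. (f (rot a t s) - f s) / t) \<longlongrightarrow> angular a f s) (at 0)" by simp
    have "filterlim h (at 0) sequentially"
      unfolding filterlim_at h_def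
      using LIMSEQ_inverse_real_of_nat by (auto simp: eventually_sequentially)
    from filterlim_compose[OF * this] show ?thesis by (simp add: q_def)
  qed
  have "(\<lambda>n. \<integral>s. q n s \<partial>surface_measure) \<longlonglongrightarrow> (\<integral>s. angular a f s \<partial>surface_measure)"
  proof (rule integral_dominated_convergence[where w = "\<lambda>_. B"])
    show "(\<lambda>s. angular a f s) \<in> borel_measurable surface_measure"
      by (rule surface_measurable_continuous[OF ca])
    show "(\<lambda>s. q n s) \<in> borel_measurable surface_measure" for n
      unfolding q_def using surface_measurable_continuous[OF crot] surface_measurable_continuous[OF cf]
      by measurable
    show "AE s in surface_measure. (\<lambda>n. q n s) \<longlonglongrightarrow> angular a f s"
      using lim by (auto intro!: AE_I2)
    show "AE s in surface_measure. norm (q n s) \<le> B" for n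
      using bound by (auto intro!: AE_I2)
  qed simp
  then show ?thesis
    unfolding zero by (simp add: LIMSEQ_const_iff)
qed

lemma integral_angular_by_parts:
  assumes a: "norm a = 1" and f: "C1_on_S2 f" and g: "C1_on_S2 g"
  shows "(\<integral>s. angular a f s * g s \<partial>surface_measure) = - (\<integral>s. f s * angular a g s \<partial>surface_measure)"
proof -
  have "0 = (\<integral>s. angular a (\<lambda>x. f x * g x) s \<partial>surface_measure)"
    using integral_angular[OF a C1_on_S2_mult[OF f g]] by simp
  also have "\<dots> = (\<integral>s. f s * angular a g s + angular a f s * g s \<partial>surface_measure)"
    using f g by (intro Bochner_Integration.integral_cong) (auto simp: angular_mult C1_on_S2_def)
  also have "\<dots> = (\<integral>s. f s * angular a g s \<partial>surface_measure) + (\<integral>s. angular a f s * g s \<partial>surface_measure)"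
    using C1_on_S2_continuous[OF f] C1_on_S2_continuous[OF g]
      C1_on_S2_angular_continuous[OF f] C1_on_S2_angular_continuous[OF g]
    by (intro Bochner_Integration.integral_add surface_integrable_continuous continuous_intros)
  finally show ?thesis by simp
qed

section \<open>Polynomials of bounded degree and the spherical Laplacian\<close>

text \<open>Polynomial functions of degree at most \<open>n\<close>. Building them up by multiplication with linear forms, instead
of by coefficients, makes the rotation invariance immediate and suits the product rule.\<close>

inductive deg_le :: "nat \<Rightarrow> (real^3 \<Rightarrow> real) \<Rightarrow> bool" where
  const: "deg_le n (\<lambda>x. c)"
| add: "deg_le n f \<Longrightarrow> deg_le n g \<Longrightarrow> deg_le n (\<lambda>x. f x + g x)"
| mult: "deg_le n f \<Longrightarrow> deg_le (Suc n) (\<lambda>x. (w \<bullet> x) * f x)"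

lemma deg_le_Suc: "deg_le n f \<Longrightarrow> deg_le (Suc n) f"
  by (induction rule: deg_le.induct) (auto intro: deg_le.intros)

lemma deg_le_mono: "deg_le n f \<Longrightarrow> n \<le> m \<Longrightarrow> deg_le m f"
  by (induction m rule: nat_induct) (auto simp: le_Suc_eq intro: deg_le_Suc)

lemma deg_le_scale: "deg_le n f \<Longrightarrow> deg_le n (\<lambda>x. c * f x)"
proof (induction rule: deg_le.induct)
  case (const n c')
  show ?case by (rule deg_le.const)
next
  case (add n f g)
  then show ?case by (simp add: distrib_left deg_le.add)
next
  case (mult n f w)
  from deg_le.mult[OF mult.IH, of w] show ?case by (simp add: mult.left_commute)
qed

lemma deg_le_sum: "finite I \<Longrightarrow> (\<And>i. i \<in> I \<Longrightarrow> deg_le n (f i)) \<Longrightarrow> deg_le n (\<lambda>x. \<Sum>i\<in>I. f i x)"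
  by (induction rule: finite_induct) (auto intro: deg_le.intros)

lemma deg_le_diff: "deg_le n f \<Longrightarrow> deg_le n g \<Longrightarrow> deg_le n (\<lambda>x. f x - g x)"
  using deg_le.add[of n f "\<lambda>x. (-1) * g x"] deg_le_scale[of n g "-1"] by simp

lemma deg_le_mult:
  assumes "deg_le n f" "deg_le m g"
  shows "deg_le (n + m) (\<lambda>x. f x * g x)"
  using assms(1)
proof (induction rule: deg_le.induct)
  case (const n c)
  show ?case
    using deg_le_mono[OF deg_le_scale[OF assms(2)], of "n + m" c] by simp
next
  case (add n f h)
  then show ?case by (simp add: distrib_right deg_le.add)
next
  case (mult n f w)
  from deg_le.mult[OF mult.IH, of w] show ?case by (simp add: mult.assoc)
qed

lemma real_polynomial_function_imp_deg_le:
  fixes p :: "real^3 \<Rightarrow> real"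
  assumes "real_polynomial_function p"
  shows "\<exists>n. deg_le n p"
  using assms
proof (induction rule: real_polynomial_function.induct)
  case (linear f)
  then interpret bounded_linear f .
  have "f x = (\<Sum>i\<in>Basis. f i *\<^sub>R i) \<bullet> x * 1" for x
  proof -
    have "f x = f (\<Sum>i\<in>Basis. (x \<bullet> i) *\<^sub>R i)" by (simp only: euclidean_representation)
    also have "\<dots> = (\<Sum>i\<in>Basis. (x \<bullet> i) * f i)" by (simp add: sum scaleR)
    finally show ?thesis by (simp add: inner_sum_right inner_commute[of _ x] mult.commute)
  qed
  then have "f = (\<lambda>x. (\<Sum>i\<in>Basis. f i *\<^sub>R i) \<bullet> x * 1)" by blast
  then show ?case
    using deg_le.mult[OF deg_le.const[of 0 1], of "\<Sum>i\<in>Basis. f i *\<^sub>R i"] by auto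
next
  case (const c)
  show ?case by (blast intro: deg_le.const)
next
  case (add f g)
  then obtain n m where "deg_le n f" "deg_le m g" by blast
  then have "deg_le (max n m) f" "deg_le (max n m) g"
    using deg_le_mono by auto
  then show ?case by (blast intro: deg_le.add)
next
  case (mult f g)
  then show ?case by (blast intro: deg_le_mult)
qed

lemma deg_le_rotation:
  assumes R: "orthogonal_transformation R" and f: "deg_le n f"
  shows "deg_le n (\<lambda>x. f (R x))"
  using f
proof (induction rule: deg_le.induct)
  case (mult n f w)
  obtain v where v: "w = R v"
    using orthogonal_transformation_surj[OF R] by (metis surjD)
  have "R v \<bullet> R x = v \<bullet> x" for x
    using R by (simp add: orthogonal_transformation_def)
  then show ?case using deg_le.mult[OF mult.IH, of v] by (simp add: v)
qed (auto intro: deg_le.intros)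

lemma deg_le_has_derivative:
  assumes "deg_le n f"
  shows "\<exists>D. (\<forall>x. (f has_derivative (\<lambda>v. D v x)) (at x)) \<and> (\<forall>v. deg_le n (D v))"
  using assms
proof (induction rule: deg_le.induct)
  case (const n c)
  show ?case
    by (rule exI[of _ "\<lambda>v x. 0"]) (auto intro: deg_le.const)
next
  case (add n f g)
  then obtain D E where "\<And>x. (f has_derivative (\<lambda>v. D v x)) (at x)" "\<And>v. deg_le n (D v)"
    "\<And>x. (g has_derivative (\<lambda>v. E v x)) (at x)" "\<And>v. deg_le n (E v)" by blast
  then show ?case
    by (intro exI[of _ "\<lambda>v x. D v x + E v x"]) (auto intro!: deg_le.add has_derivative_add)
next
  case (mult n f w)
  then obtain D where D: "\<And>x. (f has_derivative (\<lambda>v. D v x)) (at x)" "\<And>v. deg_le n (D v)"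
    by blast
  have "((\<lambda>x. (w \<bullet> x) * f x) has_derivative (\<lambda>v. (w \<bullet> x) * D v x + (w \<bullet> v) * f x)) (at x)" for x
    by (rule derivative_eq_intros D refl | simp)+
  moreover have "deg_le (Suc n) (\<lambda>x. (w \<bullet> x) * D v x + (w \<bullet> v) * f x)" for v
    by (intro deg_le.add deg_le.mult D deg_le_scale deg_le_Suc mult.hyps)
  ultimately show ?case
    by (intro exI[of _ "\<lambda>v x. (w \<bullet> x) * D v x + (w \<bullet> v) * f x"]) auto
qed

lemma deg_le_differentiable: "deg_le n f \<Longrightarrow> f differentiable (at x)"
  using deg_le_has_derivative[of n f] by (auto simp: differentiable_def)

lemma deg_le_continuous: "deg_le n f \<Longrightarrow> continuous_on S f"
  by (meson continuous_at_imp_continuous_on differentiable_imp_continuous_within deg_le_differentiable)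

lemma deg_le_C1: 
  assumes "deg_le n f"
  shows "C1_on_S2 f"
proof -
  obtain D where D: "\<And>x. (f has_derivative (\<lambda>v. D v x)) (at x)" "\<And>v. deg_le n (D v)"
    using deg_le_has_derivative[OF assms] by blast
  have "frechet_derivative f (at x) v = D v x" for x v
    using frechet_derivative_at[OF D(1)] by metis
  then show ?thesis
    using deg_le_continuous[OF D(2)] deg_le_differentiable[OF assms] by (simp add: C1_on_S2_def)
qed

lemma angular_add:
  assumes "f differentiable (at x)" "g differentiable (at x)"
  shows "angular a (\<lambda>x. f x + g x) x = angular a f x + angular a g x"
  using angular_eq[OF has_derivative_add[OF assms[unfolded frechet_derivative_works]]]
  by (simp add: angular_def)

lemma angular_const: "angular a (\<lambda>x. c) x = 0"
  by (simp add: angular_def)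

lemma inner_cross3_eq: "w \<bullet> cross3 a x = cross3 w a \<bullet> x"
  by (simp add: cross3_simps)

lemma angular_inner: "angular a (\<lambda>x. w \<bullet> x) x = cross3 w a \<bullet> x"
  using angular_eq[OF bounded_linear_imp_has_derivative[OF bounded_linear_inner_right], of a w x]
  by (simp add: inner_cross3_eq)

lemma angular_linear_mult:
  assumes "f differentiable (at x)"
  shows "angular a (\<lambda>x. (w \<bullet> x) * f x) x = (w \<bullet> x) * angular a f x + (cross3 w a \<bullet> x) * f x"
  by (subst angular_mult)
    (simp_all add: assms angular_inner bounded_linear_imp_differentiable bounded_linear_inner_right)

lemma deg_le_angular: "deg_le n f \<Longrightarrow> deg_le n (angular a f)"
proof (induction rule: deg_le.induct)
  case (const n c)
  show ?case by (simp add: angular_const[abs_def] deg_le.const)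
next
  case (add n f g)
  have "angular a (\<lambda>x. f x + g x) = (\<lambda>x. angular a f x + angular a g x)"
    using add.hyps by (auto simp: angular_add deg_le_differentiable)
  then show ?case using add.IH by (simp add: deg_le.add)
next
  case (mult n f w)
  have "angular a (\<lambda>x. (w \<bullet> x) * f x) = (\<lambda>x. (w \<bullet> x) * angular a f x + (cross3 w a \<bullet> x) * f x)"
    using deg_le_differentiable[OF mult.hyps] by (auto simp: angular_linear_mult)
  then show ?case
    using mult by (simp add: deg_le.add deg_le.mult)
qed

definition spherical_laplacian :: "(real^3 \<Rightarrow> real) \<Rightarrow> real^3 \<Rightarrow> real" where
  "spherical_laplacian f x = (\<Sum>k\<in>UNIV. angular (axis k 1) (angular (axis k 1) f) x)"

lemma deg_le_laplacian: "deg_le n f \<Longrightarrow> deg_le n (spherical_laplacian f)"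
  unfolding spherical_laplacian_def[abs_def] by (intro deg_le_sum deg_le_angular) auto

text \<open>For a unit vector \<open>x\<close> the right hand side is the inner product of the tangential parts of \<open>v\<close> and \<open>w\<close>.\<close>

lemma sum_inner_cross_axis:
  fixes v w x :: "real^3"
  shows "(\<Sum>k\<in>UNIV. (w \<bullet> cross3 (axis k 1) x) * (v \<bullet> cross3 (axis k 1) x))
    = (x \<bullet> x) * (w \<bullet> v) - (w \<bullet> x) * (v \<bullet> x)"
  by (simp add: sum_3 cross3_simps axis_def)

lemma sum_inner_cross_axis':
  fixes v w x :: "real^3"
  shows "(\<Sum>k\<in>UNIV. (cross3 w (axis k 1) \<bullet> x) * (cross3 v (axis k 1) \<bullet> x))
    = (x \<bullet> x) * (w \<bullet> v) - (w \<bullet> x) * (v \<bullet> x)"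
  using sum_inner_cross_axis[of w x v] by (simp only: inner_cross3_eq)

lemma spherical_laplacian_linear_mult:
  assumes f: "deg_le n f"
  shows "spherical_laplacian (\<lambda>x. (w \<bullet> x) * f x) x = (w \<bullet> x) * spherical_laplacian f x
    + 2 * (\<Sum>k\<in>UNIV. (cross3 w (axis k 1) \<bullet> x) * angular (axis k 1) f x) - 2 * (w \<bullet> x) * f x"
proof -
  have 1: "angular a (\<lambda>x. (w \<bullet> x) * f x) = (\<lambda>x. (w \<bullet> x) * angular a f x + (cross3 w a \<bullet> x) * f x)" for a
    using deg_le_differentiable[OF f] by (auto simp: angular_linear_mult)
  have 2: "angular a (angular a (\<lambda>x. (w \<bullet> x) * f x)) x
    = (w \<bullet> x) * angular a (angular a f) x + 2 * ((cross3 w a \<bullet> x) * angular a f x)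
      + (cross3 (cross3 w a) a \<bullet> x) * f x" for a
    unfolding 1
    by (subst angular_add)
      (use f in \<open>auto simp: angular_linear_mult deg_le_differentiable[OF f]
         deg_le_differentiable[OF deg_le_angular[OF f]]
         intro!: deg_le_differentiable[OF deg_le.mult] deg_le_angular\<close>)
  have "(\<Sum>k\<in>UNIV. cross3 (cross3 w (axis k 1)) (axis k 1) \<bullet> x) = - 2 * (w \<bullet> x)"
    by (simp add: sum_3 cross3_simps axis_def)
  then have "(\<Sum>k\<in>UNIV. (cross3 (cross3 w (axis k 1)) (axis k 1) \<bullet> x) * f x) = - 2 * (w \<bullet> x) * f x"
    by (simp flip: sum_distrib_right)
  then show ?thesis
    unfolding spherical_laplacian_def 2
    by (simp add: sum.distrib sum_distrib_left)
qed

text \<open>For unit \<open>s\<close> the left hand side is the inner product of the tangential gradients of \<open>f\<close> and of the linear form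
\<open>w\<close>. It equals the Euclidean one minus the product of the radial parts, and the radial derivative
multiplies the top degree part of \<open>f\<close> by \<open>n\<close>, whereas the Euclidean gradient lowers the degree.\<close>

lemma angular_gradient_linear:
  assumes "deg_le n f"
  shows "\<exists>g. deg_le n g \<and> (\<forall>s\<in>S2.
    (\<Sum>k\<in>UNIV. (cross3 w (axis k 1) \<bullet> s) * angular (axis k 1) f s) = - real n * (w \<bullet> s) * f s + g s)"
  using assms
proof (induction rule: deg_le.induct)
  case (const n c)
  have "deg_le n (\<lambda>x. real n * c * (w \<bullet> x))"
  proof (cases n)
    case (Suc m)
    from deg_le.mult[OF deg_le.const[of m "real n * c"], of w]
    show ?thesis by (simp add: Suc mult.commute)
  qed (simp add: deg_le.const)
  then show ?case
    by (intro exI[of _ "\<lambda>x. real n * c * (w \<bullet> x)"]) (auto simp: angular_const)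
next
  case (add n f f')
  from add.IH(1) obtain g where g: "deg_le n g"
    "\<forall>s\<in>S2. (\<Sum>k\<in>UNIV. (cross3 w (axis k 1) \<bullet> s) * angular (axis k 1) f s) = - real n * (w \<bullet> s) * f s + g s" by blast
  from add.IH(2) obtain g' where g': "deg_le n g'"
    "\<forall>s\<in>S2. (\<Sum>k\<in>UNIV. (cross3 w (axis k 1) \<bullet> s) * angular (axis k 1) f' s) = - real n * (w \<bullet> s) * f' s + g' s" by blast
  have "angular a (\<lambda>x. f x + f' x) s = angular a f s + angular a f' s" for a s
    using add.hyps by (simp add: angular_add deg_le_differentiable)
  then show ?case
    using g g' by (intro exI[of _ "\<lambda>x. g x + g' x"])
      (auto intro!: deg_le.add simp: distrib_left sum.distrib)
next
  case (mult n f v)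
  from mult.IH obtain g where g: "deg_le n g"
    "\<forall>s\<in>S2. (\<Sum>k\<in>UNIV. (cross3 w (axis k 1) \<bullet> s) * angular (axis k 1) f s) = - real n * (w \<bullet> s) * f s + g s" by blast
  show ?case
  proof (intro exI[of _ "\<lambda>x. (v \<bullet> x) * g x + (w \<bullet> v) * f x"] conjI ballI)
    show "deg_le (Suc n) (\<lambda>x. (v \<bullet> x) * g x + (w \<bullet> v) * f x)"
      using g(1) mult.hyps by (intro deg_le.add deg_le.mult deg_le_Suc deg_le_scale)
    fix s assume s: "s \<in> S2"
    then have ss: "s \<bullet> s = 1" by (simp add: dot_square_norm)
    have "(\<Sum>k\<in>UNIV. (cross3 w (axis k 1) \<bullet> s) * angular (axis k 1) (\<lambda>x. (v \<bullet> x) * f x) s)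
      = (v \<bullet> s) * (\<Sum>k\<in>UNIV. (cross3 w (axis k 1) \<bullet> s) * angular (axis k 1) f s)
      + (\<Sum>k\<in>UNIV. (cross3 w (axis k 1) \<bullet> s) * (cross3 v (axis k 1) \<bullet> s)) * f s"
      using deg_le_differentiable[OF mult.hyps]
      unfolding sum_distrib_left sum_distrib_right sum.distrib[symmetric]
      by (intro sum.cong refl) (simp only: angular_linear_mult, simp add: algebra_simps)
    also have "\<dots> = - real (Suc n) * (w \<bullet> s) * ((v \<bullet> s) * f s) + ((v \<bullet> s) * g s + (w \<bullet> v) * f s)"
      unfolding g(2)[rule_format, OF s] sum_inner_cross_axis' ss by (simp add: algebra_simps)
    finally show "(\<Sum>k\<in>UNIV. (cross3 w (axis k 1) \<bullet> s) * angular (axis k 1) (\<lambda>x. (v \<bullet> x) * f x) s)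
      = - real (Suc n) * (w \<bullet> s) * ((v \<bullet> s) * f s) + ((v \<bullet> s) * g s + (w \<bullet> v) * f s)" .
  qed
qed

text \<open>By induction with the product rule: multiplying by a linear form adds \<open>- 2 n\<close> through the mixed term and \<open>- 2\<close>
because linear forms are themselves eigenfunctions, and \<open>n (n + 1) + 2 n + 2 = (n + 1) (n + 2)\<close>. The
degree \<open>n - 1\<close> is truncated at \<open>n = 0\<close>, so there the remainder has to be stated to be zero.\<close>

lemma spherical_laplacian_top_degree:
  assumes "deg_le n f"
  shows "\<exists>g. deg_le (n - 1) g \<and> (n = 0 \<longrightarrow> g = (\<lambda>x. 0)) \<and> (\<forall>s\<in>S2.
    spherical_laplacian f s = - (real n * (real n + 1)) * f s + g s)"
  using assms
proof (induction rule: deg_le.induct)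
  case (const n c)
  show ?case
    by (intro exI[of _ "\<lambda>x. real n * (real n + 1) * c"])
      (auto simp: spherical_laplacian_def angular_const[abs_def] deg_le.const)
next
  case (add n f f')
  from add.IH(1) obtain g where g: "deg_le (n-1) g" "n = 0 \<longrightarrow> g = (\<lambda>x. 0)"
    "\<forall>s\<in>S2. spherical_laplacian f s = - (real n * (real n + 1)) * f s + g s" by blast
  from add.IH(2) obtain g' where g': "deg_le (n-1) g'" "n = 0 \<longrightarrow> g' = (\<lambda>x. 0)"
    "\<forall>s\<in>S2. spherical_laplacian f' s = - (real n * (real n + 1)) * f' s + g' s" by blast
  have 1: "angular a (\<lambda>x. f x + f' x) = (\<lambda>s. angular a f s + angular a f' s)" for a
    using add.hyps by (auto simp: angular_add deg_le_differentiable)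
  have "angular a (angular a (\<lambda>x. f x + f' x)) s = angular a (angular a f) s + angular a (angular a f') s" for a s
    unfolding 1 using add.hyps by (simp add: angular_add deg_le_differentiable[OF deg_le_angular])
  then have "spherical_laplacian (\<lambda>x. f x + f' x) s = spherical_laplacian f s + spherical_laplacian f' s" for s
    by (simp add: spherical_laplacian_def sum.distrib)
  then show ?case
    using g g' by (intro exI[of _ "\<lambda>x. g x + g' x"])
      (auto intro!: deg_le.add simp: distrib_left)
next
  case (mult n f w)
  from mult.IH obtain g where g: "deg_le (n-1) g" "n = 0 \<longrightarrow> g = (\<lambda>x. 0)"
    "\<forall>s\<in>S2. spherical_laplacian f s = - (real n * (real n + 1)) * f s + g s" by blast
  obtain h where h: "deg_le n h" "\<forall>s\<in>S2.
    (\<Sum>k\<in>UNIV. (cross3 w (axis k 1) \<bullet> s) * angular (axis k 1) f s) = - real n * (w \<bullet> s) * f s + h s"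
    using angular_gradient_linear[OF mult.hyps, of w] by blast
  have d: "deg_le n (\<lambda>x. (w \<bullet> x) * g x)"
  proof (cases n)
    case (Suc m)
    then show ?thesis using deg_le.mult[OF g(1), of w] by simp
  qed (use g(2) in \<open>simp add: deg_le.const\<close>)
  show ?case
  proof (intro exI[of _ "\<lambda>x. (w \<bullet> x) * g x + 2 * h x"] conjI ballI impI)
    show "deg_le (Suc n - 1) (\<lambda>x. (w \<bullet> x) * g x + 2 * h x)"
      using d h(1) by (auto intro!: deg_le.add deg_le_scale)
    show "spherical_laplacian (\<lambda>x. (w \<bullet> x) * f x) s =
        - (real (Suc n) * (real (Suc n) + 1)) * ((w \<bullet> s) * f s) + ((w \<bullet> s) * g s + 2 * h s)"
      if "s \<in> S2" for s
      unfolding spherical_laplacian_linear_mult[OF mult.hyps] h(2)[rule_format, OF that] g(3)[rule_format, OF that]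
      by (simp add: algebra_simps)
  qed simp
qed

section \<open>Spherical harmonics by orthonormalisation of monomials\<close>

text \<open>An enumeration, ordered by degree, of the monomials with exponent at most one in the third coordinate; on
the sphere the others reduce to these. There are \<open>2 d + 1\<close> of degree \<open>d\<close>, which get the indices
from \<open>d\<^sup>2\<close> to \<open>(d + 1)\<^sup>2 - 1\<close>: first those without the third coordinate, then those with it.\<close>

definition monomial :: "nat \<Rightarrow> real^3 \<Rightarrow> real" where
  "monomial i x = (let d = floor_sqrt i; k = i - d\<^sup>2 in
     if k \<le> d then x$1 ^ k * x$2 ^ (d - k) else x$3 * (x$1 ^ (k - d - 1) * x$2 ^ (2 * d - k)))"

lemma monomial_xy: "monomial ((a + b)\<^sup>2 + a) x = x$1 ^ a * x$2 ^ b"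
proof -
  have "floor_sqrt ((a + b)\<^sup>2 + a) = a + b"
    by (rule floor_sqrt_unique) (auto simp: power2_eq_square)
  then show ?thesis by (simp add: monomial_def Let_def)
qed

lemma monomial_zxy: "monomial ((a + b + 1)\<^sup>2 + (a + b + 1) + (a + 1)) x = x$3 * (x$1 ^ a * x$2 ^ b)"
proof -
  have "floor_sqrt ((a + b + 1)\<^sup>2 + (a + b + 1) + (a + 1)) = a + b + 1"
    by (rule floor_sqrt_unique) (auto simp: power2_eq_square)
  then show ?thesis by (simp add: monomial_def Let_def)
qed

lemma floor_sqrt_less_iff: "floor_sqrt y < x \<longleftrightarrow> y < x\<^sup>2"
  using le_floor_sqrt_iff[of x y] by (simp flip: not_le)

lemma deg_le_coordinate_power: "deg_le k (\<lambda>x. x$i ^ k)"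
proof (induction k)
  case (Suc k)
  from deg_le.mult[OF Suc, of "axis i 1"] show ?case by (simp add: inner_axis')
qed (simp add: deg_le.const)

lemma deg_le_monomial: "deg_le (floor_sqrt i) (monomial i)"
proof -
  define d k where "d = floor_sqrt i" and "k = i - d\<^sup>2"
  have k: "k \<le> 2 * d"
    using Suc_floor_sqrt_power2_gt[of i] by (simp add: d_def k_def power2_eq_square)
  show ?thesis
  proof (cases "k \<le> d")
    case True
    have "monomial i = (\<lambda>x. x$1 ^ k * x$2 ^ (d - k))"
      using True by (auto simp: monomial_def Let_def d_def k_def)
    then show ?thesis
      using deg_le_mult[OF deg_le_coordinate_power[of k 1] deg_le_coordinate_power[of "d - k" 2]] True
      by (simp add: d_def)
  next
    case False
    have "monomial i = (\<lambda>x. x$3 * (x$1 ^ (k - d - 1) * x$2 ^ (2 * d - k)))"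
      using False by (auto simp: monomial_def Let_def d_def k_def)
    moreover have "Suc (d - Suc 0) = d" using False k by simp
    ultimately show ?thesis
      using deg_le_mult[OF deg_le_coordinate_power[of 1 3]
          deg_le_mult[OF deg_le_coordinate_power[of "k - d - 1" 1] deg_le_coordinate_power[of "2 * d - k" 2]]]
        False k
      by (simp add: d_def)
  qed
qed

text \<open>Linear combinations are formed on the sphere only, so that its equation may be used.\<close>

definition spanned :: "(nat \<Rightarrow> real^3 \<Rightarrow> real) \<Rightarrow> nat \<Rightarrow> (real^3 \<Rightarrow> real) \<Rightarrow> bool" where
  "spanned b m f \<longleftrightarrow> (\<exists>c. \<forall>s\<in>S2. f s = (\<Sum>i<m. c i * b i s))"

lemma spanned_cong: "(\<And>s. s \<in> S2 \<Longrightarrow> f s = g s) \<Longrightarrow> spanned b m f \<longleftrightarrow> spanned b m g"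
  by (simp add: spanned_def)

lemma spanned_base: "i < m \<Longrightarrow> spanned b m (b i)"
  unfolding spanned_def
  by (rule exI[of _ "\<lambda>j. if j = i then 1 else 0"]) (simp add: if_distrib[of "\<lambda>c. c * _"] sum.delta cong: if_cong)

lemma spanned_add: "spanned b m f \<Longrightarrow> spanned b m g \<Longrightarrow> spanned b m (\<lambda>x. f x + g x)"
proof -
  assume "spanned b m f" "spanned b m g"
  then obtain c d where "\<forall>s\<in>S2. f s = (\<Sum>i<m. c i * b i s)" "\<forall>s\<in>S2. g s = (\<Sum>i<m. d i * b i s)"
    unfolding spanned_def by blast
  then show ?thesis unfolding spanned_def
    by (intro exI[of _ "\<lambda>i. c i + d i"]) (simp add: distrib_right sum.distrib)
qed

lemma spanned_scale: "spanned b m f \<Longrightarrow> spanned b m (\<lambda>x. c * f x)"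
proof -
  assume "spanned b m f"
  then obtain d where "\<forall>s\<in>S2. f s = (\<Sum>i<m. d i * b i s)"
    unfolding spanned_def by blast
  then show ?thesis unfolding spanned_def
    by (intro exI[of _ "\<lambda>i. c * d i"]) (simp add: sum_distrib_left mult.assoc)
qed

lemma spanned_zero: "spanned b m (\<lambda>x. 0)"
  unfolding spanned_def by (rule exI[of _ "\<lambda>_. 0"]) simp

lemma spanned_sum: "finite I \<Longrightarrow> (\<And>i. i \<in> I \<Longrightarrow> spanned b m (f i)) \<Longrightarrow> spanned b m (\<lambda>x. \<Sum>i\<in>I. f i x)"
  by (induction rule: finite_induct) (auto intro: spanned_add spanned_zero)

lemma spanned_monomial_xy:
  assumes "a + b \<le> n"
  shows "spanned monomial ((n + 1)\<^sup>2) (\<lambda>x. x$1 ^ a * x$2 ^ b)"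
proof -
  have "(a + b)\<^sup>2 \<le> n\<^sup>2" using assms by (simp add: power_mono)
  then have "(a + b)\<^sup>2 + a < (n + 1)\<^sup>2" using assms by (simp add: power2_eq_square)
  from spanned_base[OF this, of monomial] show ?thesis
    by (simp add: monomial_xy[abs_def])
qed

lemma spanned_monomial_zxy:
  assumes "a + b + 1 \<le> n"
  shows "spanned monomial ((n + 1)\<^sup>2) (\<lambda>x. x$3 * (x$1 ^ a * x$2 ^ b))"
proof -
  have "(a + b + 1)\<^sup>2 \<le> n\<^sup>2" using assms by (intro power_mono) auto
  then have "(a + b + 1)\<^sup>2 + (a + b + 1) + (a + 1) < (n + 1)\<^sup>2"
    using assms by (simp add: power2_eq_square)
  from spanned_base[OF this, of monomial] show ?thesis
    by (simp only: monomial_zxy[abs_def])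
qed

lemma S2_coordinates: "s \<in> S2 \<Longrightarrow> s$3 * s$3 = 1 - s$1 * s$1 - s$2 * s$2"
  using dot_square_norm[of s] by (simp add: inner_vec_def sum_3)

lemma spanned_coordinate_mult_monomial:
  assumes i: "i < (n + 1)\<^sup>2"
  shows "spanned monomial ((n + 2)\<^sup>2) (\<lambda>x. x$j * monomial i x)"
proof -
  note xy = spanned_monomial_xy[of _ _ "n + 1", simplified]
  note zxy = spanned_monomial_zxy[of _ _ "n + 1", simplified]
  define d k where "d = floor_sqrt i" and "k = i - d\<^sup>2"
  have k: "k \<le> 2 * d"
    using Suc_floor_sqrt_power2_gt[of i] by (simp add: d_def k_def power2_eq_square)
  have "d\<^sup>2 < (n + 1)\<^sup>2" using i floor_sqrt_power2_le[of i] unfolding d_def by linarith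
  then have d: "d \<le> n" using power_less_imp_less_base by fastforce
  consider "j = 1" | "j = 2" | "j = 3" using exhaust_3 by blast
  note j = this
  show ?thesis
  proof (cases "k \<le> d")
    case True
    have eq: "monomial i = (\<lambda>x. x$1 ^ k * x$2 ^ (d - k))"
      using True by (auto simp: monomial_def Let_def d_def k_def)
    from j show ?thesis
    proof cases
      case 1
      show ?thesis using xy[of "Suc k" "d - k"] d True by (simp add: eq 1 mult_ac)
    next
      case 2
      show ?thesis using xy[of k "Suc (d - k)"] d True by (simp add: eq 2 mult_ac)
    next
      case 3
      show ?thesis using zxy[of k "d - k"] d True by (simp add: eq 3)
    qed
  next
    case False
    define a b where "a = k - d - 1" and "b = 2 * d - k"
    have ab: "a + b + 1 \<le> n" using False k d by (simp add: a_def b_def)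
    have eq: "monomial i = (\<lambda>x. x$3 * (x$1 ^ a * x$2 ^ b))"
      using False by (auto simp: monomial_def Let_def d_def k_def a_def b_def)
    from j show ?thesis
    proof cases
      case 1
      show ?thesis using zxy[of "Suc a" b] ab by (simp add: eq 1 mult_ac)
    next
      case 2
      show ?thesis using zxy[of a "Suc b"] ab by (simp add: eq 2 mult_ac)
    next
      case 3
      have "spanned monomial ((n + 2)\<^sup>2) (\<lambda>x. (x$1 ^ a * x$2 ^ b)
          + ((- 1) * (x$1 ^ Suc (Suc a) * x$2 ^ b) + (- 1) * (x$1 ^ a * x$2 ^ Suc (Suc b))))"
        using ab xy[of a b] xy[of "Suc (Suc a)" b] xy[of a "Suc (Suc b)"]
        by (intro spanned_add spanned_scale) simp_all
      then show ?thesis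
      proof (rule iffD1[OF spanned_cong, rotated])
        fix s :: "real^3" assume "s \<in> S2"
        have "s$3 * (s$3 * (s$1 ^ a * s$2 ^ b)) = (s$3 * s$3) * (s$1 ^ a * s$2 ^ b)" by simp
        then show "(s$1 ^ a * s$2 ^ b)
          + ((- 1) * (s$1 ^ Suc (Suc a) * s$2 ^ b) + (- 1) * (s$1 ^ a * s$2 ^ Suc (Suc b)))
          = s$j * monomial i s"
          unfolding eq 3 S2_coordinates[OF \<open>s \<in> S2\<close>] by (simp add: algebra_simps)
      qed
    qed
  qed
qed

text \<open>The dimension bound. A square of the third coordinate is replaced by means of the equation of the sphere,
which does not raise the degree.\<close>

lemma deg_le_spanned: "deg_le n f \<Longrightarrow> spanned monomial ((n + 1)\<^sup>2) f"
proof (induction rule: deg_le.induct)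
  case (const n c)
  show ?case
    using spanned_scale[OF spanned_monomial_xy[of 0 0 n], of c] by simp
next
  case (add n f g)
  then show ?case by (simp add: spanned_add)
next
  case (mult n f w)
  then obtain c where c: "\<forall>s\<in>S2. f s = (\<Sum>i<(n + 1)\<^sup>2. c i * monomial i s)"
    unfolding spanned_def by blast
  have "spanned monomial ((n + 2)\<^sup>2)
     (\<lambda>x. \<Sum>i<(n + 1)\<^sup>2. \<Sum>j\<in>UNIV. (w$j * c i) * (x$j * monomial i x))"
    by (intro spanned_sum spanned_scale spanned_coordinate_mult_monomial) auto
  then have "spanned monomial ((n + 2)\<^sup>2) (\<lambda>x. (w \<bullet> x) * f x)"
    by (rule iffD1[OF spanned_cong, rotated])
      (simp add: c inner_vec_def sum_distrib_left sum_distrib_right mult_ac)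
  then show ?case by simp
qed

definition S2_inner :: "(real^3 \<Rightarrow> real) \<Rightarrow> (real^3 \<Rightarrow> real) \<Rightarrow> real" where
  "S2_inner f g = (\<integral>s. f s * g s \<partial>surface_measure)"

lemma S2_inner_commute: "S2_inner f g = S2_inner g f"
  by (simp add: S2_inner_def mult.commute)

lemma S2_inner_zero [simp]: "S2_inner (\<lambda>s. 0) g = 0" "S2_inner g (\<lambda>s. 0) = 0"
  by (simp_all add: S2_inner_def)

lemma S2_inner_cong:
  "(\<And>s. s \<in> S2 \<Longrightarrow> f s = f' s) \<Longrightarrow> (\<And>s. s \<in> S2 \<Longrightarrow> g s = g' s) \<Longrightarrow> S2_inner f g = S2_inner f' g'"
  unfolding S2_inner_def by (intro Bochner_Integration.integral_cong) auto

lemma S2_inner_scale: "S2_inner (\<lambda>s. c * f s) g = c * S2_inner f g"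
  by (simp add: S2_inner_def mult.assoc)

lemma S2_inner_scale_right: "S2_inner f (\<lambda>s. c * g s) = c * S2_inner f g"
  by (simp add: S2_inner_commute[of f] S2_inner_scale)

definition sq_integrable :: "(real^3 \<Rightarrow> real) \<Rightarrow> bool" where
  "sq_integrable f \<longleftrightarrow> f \<in> borel_measurable surface_measure \<and> integrable surface_measure (\<lambda>s. (f s)\<^sup>2)"

lemma sq_integrable_continuous: "continuous_on S2 f \<Longrightarrow> sq_integrable f"
  unfolding sq_integrable_def
  by (auto intro!: surface_measurable_continuous surface_integrable_continuous continuous_intros)

lemma sq_integrable_mult:
  assumes "sq_integrable f" "sq_integrable g"
  shows "integrable surface_measure (\<lambda>s. f s * g s)"
proof (rule Bochner_Integration.integrable_bound[where f = "\<lambda>s. (f s)\<^sup>2 + (g s)\<^sup>2"])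
  show "integrable surface_measure (\<lambda>s. (f s)\<^sup>2 + (g s)\<^sup>2)"
    using assms by (simp add: sq_integrable_def)
  show "(\<lambda>s. f s * g s) \<in> borel_measurable surface_measure"
    using assms by (intro borel_measurable_times) (simp_all add: sq_integrable_def)
  have "\<bar>x * y\<bar> \<le> x\<^sup>2 + y\<^sup>2" for x y :: real
    using sum_squares_bound[of "\<bar>x\<bar>" "\<bar>y\<bar>"] mult_nonneg_nonneg[of "\<bar>x\<bar>" "\<bar>y\<bar>"]
    unfolding abs_mult power2_abs by linarith
  then show "AE s in surface_measure. norm (f s * g s) \<le> norm ((f s)\<^sup>2 + (g s)\<^sup>2)"
    by (intro AE_I2) (auto intro: order_trans[OF _ abs_ge_self])
qed

lemma sq_integrable_add:
  assumes "sq_integrable f" "sq_integrable g"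
  shows "sq_integrable (\<lambda>s. f s + g s)"
proof -
  have "integrable surface_measure (\<lambda>s. (f s)\<^sup>2 + 2 * (f s * g s) + (g s)\<^sup>2)"
    using assms sq_integrable_mult[OF assms] by (auto simp: sq_integrable_def)
  then show ?thesis
    using assms borel_measurable_add[of f surface_measure g]
    by (simp add: sq_integrable_def power2_sum mult.assoc add_ac)
qed

lemma sq_integrable_scale: "sq_integrable f \<Longrightarrow> sq_integrable (\<lambda>s. c * f s)"
  by (auto simp: sq_integrable_def power_mult_distrib)

lemma sq_integrable_diff: "sq_integrable f \<Longrightarrow> sq_integrable g \<Longrightarrow> sq_integrable (\<lambda>s. f s - g s)"
  using sq_integrable_add[of f "\<lambda>s. (-1) * g s"] sq_integrable_scale[of g "-1"] by simp

lemma sq_integrable_sum: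
  assumes "\<And>i. i \<in> I \<Longrightarrow> sq_integrable (f i)"
  shows "sq_integrable (\<lambda>s. \<Sum>i\<in>I. f i s)"
  using assms
  by (induction I rule: infinite_finite_induct)
    (auto intro: sq_integrable_add simp: sq_integrable_continuous)

lemma S2_inner_add:
  assumes "sq_integrable f" "sq_integrable g" "sq_integrable h"
  shows "S2_inner (\<lambda>s. f s + g s) h = S2_inner f h + S2_inner g h"
  unfolding S2_inner_def distrib_right using assms
  by (intro Bochner_Integration.integral_add sq_integrable_mult)

lemma S2_inner_diff:
  assumes "sq_integrable f" "sq_integrable g" "sq_integrable h"
  shows "S2_inner (\<lambda>s. f s - g s) h = S2_inner f h - S2_inner g h"
  unfolding S2_inner_def left_diff_distrib using assms
  by (intro Bochner_Integration.integral_diff sq_integrable_mult)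

lemma S2_inner_sum:
  assumes "\<And>i. i \<in> I \<Longrightarrow> sq_integrable (f i)" "sq_integrable h"
  shows "S2_inner (\<lambda>s. \<Sum>i\<in>I. f i s) h = (\<Sum>i\<in>I. S2_inner (f i) h)"
  unfolding S2_inner_def sum_distrib_right using assms
  by (intro Bochner_Integration.integral_sum sq_integrable_mult)

lemma S2_inner_self_nonneg: "S2_inner f f \<ge> 0"
  by (simp add: S2_inner_def)

lemma S2_inner_self_eq_0:
  assumes "continuous_on S2 f" "S2_inner f f = 0" "s \<in> S2"
  shows "f s = 0"
  using surface_integral_square_eq_0[OF assms(1) _ assms(3)] assms(2)
  by (simp add: S2_inner_def power2_eq_square)

text \<open>The Gram-Schmidt process for the monomials. A vanishing residual yields the zero function, so the results
are orthogonal and each is either normalised or zero.\<close>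

fun harmonic :: "nat \<Rightarrow> real^3 \<Rightarrow> real" where
  "harmonic n = (let r = (\<lambda>x. monomial n x - (\<Sum>i<n. S2_inner (monomial n) (harmonic i) * harmonic i x))
     in if S2_inner r r = 0 then (\<lambda>x. 0) else (\<lambda>x. r x / sqrt (S2_inner r r)))"

declare harmonic.simps [simp del]

definition harmonic_residual :: "nat \<Rightarrow> real^3 \<Rightarrow> real" where
  "harmonic_residual n x = monomial n x - (\<Sum>i<n. S2_inner (monomial n) (harmonic i) * harmonic i x)"

lemma harmonic_eq:
  "harmonic n = (if S2_inner (harmonic_residual n) (harmonic_residual n) = 0 then (\<lambda>x. 0)
     else (\<lambda>x. inverse (sqrt (S2_inner (harmonic_residual n) (harmonic_residual n))) * harmonic_residual n x))"
  unfolding harmonic_residual_def[abs_def]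
  by (subst harmonic.simps) (simp add: Let_def divide_inverse mult.commute)

lemma deg_le_harmonic: "deg_le (floor_sqrt n) (harmonic n)"
proof (induction n rule: less_induct)
  case (less n)
  have "deg_le (floor_sqrt n) (harmonic i)" if "i < n" for i
    using deg_le_mono[OF less[OF that]] mono_floor_sqrt'[of i n] that by simp
  then have "deg_le (floor_sqrt n) (harmonic_residual n)"
    unfolding harmonic_residual_def[abs_def]
    by (intro deg_le_diff deg_le_monomial deg_le_sum deg_le_scale) auto
  then show ?case
    by (subst harmonic_eq) (auto intro: deg_le.const deg_le_scale)
qed

lemma continuous_harmonic [continuous_intros]: "continuous_on S (harmonic n)"
  by (rule deg_le_continuous[OF deg_le_harmonic])

lemma sq_integrable_harmonic: "sq_integrable (harmonic n)"
  by (rule sq_integrable_continuous[OF continuous_harmonic])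

lemmas sq_intros = sq_integrable_diff sq_integrable_add sq_integrable_sum sq_integrable_scale
  sq_integrable_harmonic

lemma continuous_harmonic_residual: "continuous_on S (harmonic_residual n)"
  unfolding harmonic_residual_def[abs_def]
  by (intro continuous_intros deg_le_continuous[OF deg_le_monomial])

lemma harmonic_zero_or_unit:
  "harmonic n = (\<lambda>x. 0) \<or> S2_inner (harmonic n) (harmonic n) = 1"
proof (cases "S2_inner (harmonic_residual n) (harmonic_residual n) = 0")
  case False
  then have "S2_inner (harmonic n) (harmonic n) =
      (inverse (sqrt (S2_inner (harmonic_residual n) (harmonic_residual n))))\<^sup>2
        * S2_inner (harmonic_residual n) (harmonic_residual n)"
    by (simp add: harmonic_eq[of n] S2_inner_scale S2_inner_scale_right power2_eq_square)
  then show ?thesis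
    using False S2_inner_self_nonneg[of "harmonic_residual n"] by (simp add: power_inverse)
qed (simp add: harmonic_eq)

lemma harmonic_norm_le: "S2_inner (harmonic n) (harmonic n) \<le> 1"
  using harmonic_zero_or_unit[of n] by (auto simp: S2_inner_def)

lemma harmonic_orthogonal_less: "j < n \<Longrightarrow> S2_inner (harmonic n) (harmonic j) = 0"
proof (induction n arbitrary: j rule: less_induct)
  case (less n)
  note IH = less.IH
  have orth: "S2_inner (harmonic i) (harmonic j) = 0" if "i < n" "j < n" "i \<noteq> j" for i j
  proof (cases i j rule: linorder_cases)
    case less
    then show ?thesis using IH[of j i] that S2_inner_commute[of "harmonic i" "harmonic j"] by simp
  next
    case greater
    then show ?thesis using IH[of i j] that by simp
  qed (use that in simp)
  have "S2_inner (harmonic_residual n) (harmonic j)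
      = S2_inner (monomial n) (harmonic j)
        - (\<Sum>i<n. S2_inner (monomial n) (harmonic i) * S2_inner (harmonic i) (harmonic j))"
    unfolding harmonic_residual_def[abs_def]
    by (subst S2_inner_diff, (intro sq_intros sq_integrable_continuous deg_le_continuous[OF deg_le_monomial])+,
        subst S2_inner_sum, (intro sq_intros)+, simp add: S2_inner_scale)
  also have "(\<Sum>i<n. S2_inner (monomial n) (harmonic i) * S2_inner (harmonic i) (harmonic j))
      = (\<Sum>i<n. if i = j then S2_inner (monomial n) (harmonic j) * S2_inner (harmonic j) (harmonic j) else 0)"
    using less.prems by (intro sum.cong) (auto simp: orth)
  also have "\<dots> = S2_inner (monomial n) (harmonic j) * S2_inner (harmonic j) (harmonic j)"
    using less.prems by simp
  also have "S2_inner (monomial n) (harmonic j) - \<dots> = 0"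
    using harmonic_zero_or_unit[of j] by (auto simp: S2_inner_def)
  finally show ?case
    by (subst harmonic_eq) (auto simp: S2_inner_scale S2_inner_zero)
qed

lemma harmonic_orthogonal: "i \<noteq> j \<Longrightarrow> S2_inner (harmonic i) (harmonic j) = 0"
  using harmonic_orthogonal_less[of i j] harmonic_orthogonal_less[of j i]
    S2_inner_commute[of "harmonic i" "harmonic j"]
  by (cases i j rule: linorder_cases) auto

lemma spanned_mono:
  assumes "spanned b m f" "m \<le> n"
  shows "spanned b n f"
proof -
  obtain c where "\<forall>s\<in>S2. f s = (\<Sum>i<m. c i * b i s)" using assms unfolding spanned_def by blast
  moreover have "(\<Sum>i<m. c i * b i s) = (\<Sum>i<n. (if i < m then c i else 0) * b i s)" for s
    using assms(2) by (intro sum.mono_neutral_cong_left) auto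
  ultimately show ?thesis unfolding spanned_def by auto
qed

lemma monomial_spanned_harmonic: "spanned harmonic (Suc n) (monomial n)"
proof -
  let ?N = "sqrt (S2_inner (harmonic_residual n) (harmonic_residual n))"
  have res: "harmonic_residual n s = ?N * harmonic n s" if "s \<in> S2" for s
    using S2_inner_self_eq_0[OF continuous_harmonic_residual _ that, of n]
    by (cases "S2_inner (harmonic_residual n) (harmonic_residual n) = 0") (simp_all add: harmonic_eq[of n])
  have "spanned harmonic (Suc n) (\<lambda>x. ?N * harmonic n x + (\<Sum>i<n. S2_inner (monomial n) (harmonic i) * harmonic i x))"
    by (intro spanned_add spanned_scale spanned_sum spanned_base) auto
  then show ?thesis
    by (rule iffD1[OF spanned_cong, rotated]) (simp add: res[symmetric] harmonic_residual_def)
qed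

lemma deg_le_spanned_harmonic:
  assumes "deg_le n f"
  shows "spanned harmonic ((n + 1)\<^sup>2) f"
proof -
  obtain c where c: "\<forall>s\<in>S2. f s = (\<Sum>i<(n + 1)\<^sup>2. c i * monomial i s)"
    using deg_le_spanned[OF assms] unfolding spanned_def by blast
  have "spanned harmonic ((n + 1)\<^sup>2) (\<lambda>s. \<Sum>i<(n + 1)\<^sup>2. c i * monomial i s)"
    by (intro spanned_sum spanned_scale) (auto intro!: spanned_mono[OF monomial_spanned_harmonic])
  then show ?thesis
    by (rule iffD1[OF spanned_cong, rotated]) (simp add: c)
qed

text \<open>The coefficients may be taken to be the inner products also at an index where \<open>harmonic\<close> is zero, since both
sides then contribute nothing.\<close>

lemma harmonic_expansion:
  assumes f: "deg_le n f" and s: "s \<in> S2"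
  shows "f s = (\<Sum>i<(n + 1)\<^sup>2. S2_inner f (harmonic i) * harmonic i s)"
proof -
  obtain c where c: "\<forall>s\<in>S2. f s = (\<Sum>i<(n + 1)\<^sup>2. c i * harmonic i s)"
    using deg_le_spanned_harmonic[OF f] unfolding spanned_def by blast
  have "S2_inner f (harmonic j) = c j * S2_inner (harmonic j) (harmonic j)" if j: "j < (n + 1)\<^sup>2" for j
  proof -
    have "S2_inner f (harmonic j) = S2_inner (\<lambda>s. \<Sum>i<(n + 1)\<^sup>2. c i * harmonic i s) (harmonic j)"
      using c by (intro S2_inner_cong) auto
    also have "\<dots> = (\<Sum>i<(n + 1)\<^sup>2. c i * S2_inner (harmonic i) (harmonic j))"
      by (subst S2_inner_sum) (auto intro!: sq_intros simp: S2_inner_scale)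
    also have "\<dots> = (\<Sum>i<(n + 1)\<^sup>2. if i = j then c j * S2_inner (harmonic j) (harmonic j) else 0)"
      by (intro sum.cong) (auto simp: harmonic_orthogonal)
    finally show ?thesis using j by simp
  qed
  then have "S2_inner f (harmonic j) * harmonic j s = c j * harmonic j s" if "j < (n + 1)\<^sup>2" for j
    using harmonic_zero_or_unit[of j] that by auto
  then have "(\<Sum>i<(n + 1)\<^sup>2. S2_inner f (harmonic i) * harmonic i s) = (\<Sum>i<(n + 1)\<^sup>2. c i * harmonic i s)"
    by (intro sum.cong) auto
  then show ?thesis using c s by simp
qed

section \<open>Spectral decomposition on the sphere\<close>

lemma harmonic_norm_mult:
  "harmonic i s * S2_inner (harmonic i) (harmonic i) = harmonic i s"
  using harmonic_zero_or_unit[of i] by auto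

lemma coefficient_norm_mult:
  "S2_inner u (harmonic i) * S2_inner (harmonic i) (harmonic i) = S2_inner u (harmonic i)"
  using harmonic_zero_or_unit[of i] by auto

lemma S2_inner_harmonic_sum_left:
  assumes "sq_integrable u"
  shows "S2_inner (\<lambda>s. \<Sum>i<m. d i * harmonic i s) u = (\<Sum>i<m. d i * S2_inner u (harmonic i))"
  by (subst S2_inner_sum)
    (auto intro!: sq_intros assms simp: S2_inner_scale S2_inner_commute[of "harmonic _" u])

lemma S2_inner_harmonic_sums:
  "S2_inner (\<lambda>s. \<Sum>i<m. d i * harmonic i s) (\<lambda>s. \<Sum>i<m. d i * harmonic i s)
    = (\<Sum>i<m. (d i)\<^sup>2 * S2_inner (harmonic i) (harmonic i))"
proof -
  have "S2_inner (\<lambda>s. \<Sum>i<m. d i * harmonic i s) (harmonic j) = d j * S2_inner (harmonic j) (harmonic j)"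
    if "j < m" for j
  proof -
    have "S2_inner (\<lambda>s. \<Sum>i<m. d i * harmonic i s) (harmonic j)
        = (\<Sum>i<m. if i = j then d j * S2_inner (harmonic j) (harmonic j) else 0)"
      unfolding S2_inner_harmonic_sum_left[OF sq_integrable_harmonic]
      by (intro sum.cong) (auto simp: harmonic_orthogonal)
    then show ?thesis using that by simp
  qed
  then show ?thesis
    by (subst S2_inner_harmonic_sum_left)
      (auto intro!: sq_intros sum.cong simp: power2_eq_square)
qed

lemma S2_distance_harmonic_sum:
  assumes u: "sq_integrable u"
  shows "S2_inner (\<lambda>s. u s - (\<Sum>i<m. d i * harmonic i s)) (\<lambda>s. u s - (\<Sum>i<m. d i * harmonic i s))
    = S2_inner u u - 2 * (\<Sum>i<m. d i * S2_inner u (harmonic i))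
      + (\<Sum>i<m. (d i)\<^sup>2 * S2_inner (harmonic i) (harmonic i))"
proof -
  let ?p = "\<lambda>s. \<Sum>i<m. d i * harmonic i s"
  have p: "sq_integrable ?p" by (intro sq_intros)
  have "S2_inner (\<lambda>s. u s - ?p s) (\<lambda>s. u s - ?p s)
     = (S2_inner u u - S2_inner ?p u) - (S2_inner u ?p - S2_inner ?p ?p)"
    by (simp only: S2_inner_diff[OF u p sq_integrable_diff[OF u p]]
        S2_inner_commute[of u "\<lambda>s. u s - ?p s"] S2_inner_commute[of ?p "\<lambda>s. u s - ?p s"]
        S2_inner_diff[OF u p u] S2_inner_diff[OF u p p])
  then show ?thesis
    unfolding S2_inner_commute[of u ?p] S2_inner_harmonic_sums S2_inner_harmonic_sum_left[OF u]
    by simp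
qed

lemma S2_projection_residual:
  assumes u: "sq_integrable u"
  shows "S2_inner (\<lambda>s. u s - (\<Sum>i<m. S2_inner u (harmonic i) * harmonic i s))
      (\<lambda>s. u s - (\<Sum>i<m. S2_inner u (harmonic i) * harmonic i s))
    = S2_inner u u - (\<Sum>i<m. (S2_inner u (harmonic i))\<^sup>2)"
proof -
  have eq: "(S2_inner u (harmonic i))\<^sup>2 * S2_inner (harmonic i) (harmonic i) = (S2_inner u (harmonic i))\<^sup>2" for i
    using coefficient_norm_mult[of u i] by (simp add: power2_eq_square mult.assoc)
  show ?thesis
    unfolding S2_distance_harmonic_sum[OF u] eq by (simp flip: power2_eq_square)
qed

lemma S2_bessel:
  assumes u: "sq_integrable u"
  shows "(\<Sum>i<m. (S2_inner u (harmonic i))\<^sup>2) \<le> S2_inner u u"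
  using S2_projection_residual[OF u, of m]
    S2_inner_self_nonneg[of "\<lambda>s. u s - (\<Sum>i<m. S2_inner u (harmonic i) * harmonic i s)"]
  by linarith

lemma S2_best_approximation:
  assumes u: "sq_integrable u"
  shows "S2_inner u u - (\<Sum>i<m. (S2_inner u (harmonic i))\<^sup>2)
    \<le> S2_inner (\<lambda>s. u s - (\<Sum>i<m. d i * harmonic i s)) (\<lambda>s. u s - (\<Sum>i<m. d i * harmonic i s))"
proof -
  have "- (S2_inner u (harmonic i))\<^sup>2
      \<le> - 2 * (d i * S2_inner u (harmonic i)) + (d i)\<^sup>2 * S2_inner (harmonic i) (harmonic i)" for i
  proof (cases "harmonic i = (\<lambda>x. 0)")
    case False
    then have "S2_inner (harmonic i) (harmonic i) = 1" using harmonic_zero_or_unit by blast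
    then show ?thesis
      using zero_le_power2[of "d i - S2_inner u (harmonic i)"] by (simp add: power2_diff)
  qed simp
  then have "(\<Sum>i<m. - (S2_inner u (harmonic i))\<^sup>2)
      \<le> (\<Sum>i<m. - 2 * (d i * S2_inner u (harmonic i)) + (d i)\<^sup>2 * S2_inner (harmonic i) (harmonic i))"
    by (intro sum_mono)
  then show ?thesis
    unfolding S2_distance_harmonic_sum[OF u]
    by (simp add: sum_subtractf sum_negf sum_distrib_left)
qed

lemma S2_inner_self_le:
  assumes "sq_integrable f" "sq_integrable g"
  shows "S2_inner (\<lambda>s. f s + g s) (\<lambda>s. f s + g s) \<le> 2 * S2_inner f f + 2 * S2_inner g g"
proof -
  have "S2_inner (\<lambda>s. f s + g s) (\<lambda>s. f s + g s)
      \<le> (\<integral>s. 2 * (f s * f s) + 2 * (g s * g s) \<partial>surface_measure)"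
    unfolding S2_inner_def
  proof (rule integral_mono)
    show "integrable surface_measure (\<lambda>s. (f s + g s) * (f s + g s))"
      by (intro sq_integrable_mult sq_integrable_add assms)
    show "integrable surface_measure (\<lambda>s. 2 * (f s * f s) + 2 * (g s * g s))"
      using sq_integrable_mult assms by auto
    show "(f s + g s) * (f s + g s) \<le> 2 * (f s * f s) + 2 * (g s * g s)" for s
      using zero_le_power2[of "f s - g s"] by (simp add: power2_eq_square algebra_simps)
  qed
  also have "\<dots> = 2 * S2_inner f f + 2 * S2_inner g g"
    unfolding S2_inner_def using sq_integrable_mult assms by (subst Bochner_Integration.integral_add) auto
  finally show ?thesis .
qed

text \<open>Polynomials are uniformly dense in the continuous functions by the Stone-Weierstrass theorem, and the partial
sums of the expansion are best approximations.\<close>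

lemma S2_parseval:
  assumes u: "sq_integrable u"
    and approx: "\<And>\<epsilon>. \<epsilon> > 0 \<Longrightarrow> \<exists>\<phi>. continuous_on S2 \<phi> \<and> S2_inner (\<lambda>s. u s - \<phi> s) (\<lambda>s. u s - \<phi> s) < \<epsilon>"
  shows "(\<lambda>m. \<Sum>i<m. (S2_inner u (harmonic i))\<^sup>2) \<longlonglongrightarrow> S2_inner u u"
proof (rule LIMSEQ_I)
  fix r :: real assume r: "r > 0"
  obtain \<phi> where \<phi>: "continuous_on S2 \<phi>" "S2_inner (\<lambda>s. u s - \<phi> s) (\<lambda>s. u s - \<phi> s) < r / 4"
    using approx[of "r / 4"] r by auto
  \<comment> \<open>Then \<open>4 \<pi> \<delta>\<^sup>2 = r / 8\<close>, so the uniform error contributes at most a quarter of \<open>r\<close>.\<close>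
  define \<delta> where "\<delta> = sqrt (r / (32 * pi))"
  have \<delta>: "\<delta> > 0" "\<delta>\<^sup>2 = r / (32 * pi)" using r by (simp_all add: \<delta>_def)
  obtain p where p: "real_polynomial_function p" "\<And>s. s \<in> S2 \<Longrightarrow> \<bar>\<phi> s - p s\<bar> < \<delta>"
    using Stone_Weierstrass_real_polynomial_function[OF compact_sphere \<phi>(1) \<delta>(1)] by blast
  obtain n where n: "deg_le n p" using real_polynomial_function_imp_deg_le[OF p(1)] by blast
  let ?d = "\<lambda>i. S2_inner p (harmonic i)"
  let ?N = "(n + 1)\<^sup>2"
  have cp: "continuous_on S2 p" by (rule deg_le_continuous[OF n])
  have sq: "sq_integrable (\<lambda>s. u s - \<phi> s)" "sq_integrable (\<lambda>s. \<phi> s - p s)"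
    using u \<phi>(1) cp by (simp_all add: sq_integrable_diff sq_integrable_continuous)
  have "S2_inner (\<lambda>s. \<phi> s - p s) (\<lambda>s. \<phi> s - p s) \<le> (\<integral>s. \<delta>\<^sup>2 \<partial>surface_measure)"
    unfolding S2_inner_def
  proof (rule integral_mono_AE)
    show "integrable surface_measure (\<lambda>s. (\<phi> s - p s) * (\<phi> s - p s))"
      by (intro sq_integrable_mult sq)
    have "(\<phi> s - p s) * (\<phi> s - p s) \<le> \<delta>\<^sup>2" if "s \<in> S2" for s
      using power_mono[OF less_imp_le[OF p(2)[OF that]], of 2] by (simp add: power2_eq_square)
    then show "AE s in surface_measure. (\<phi> s - p s) * (\<phi> s - p s) \<le> \<delta>\<^sup>2"
      by (intro AE_I2) simp
  qed simp
  also have "\<dots> = 4 * pi * (r / (32 * pi))"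
    by (simp add: \<delta>(2) measure_surface_S2)
  also have "\<dots> = r / 8" by simp
  finally have "S2_inner (\<lambda>s. (u s - \<phi> s) + (\<phi> s - p s)) (\<lambda>s. (u s - \<phi> s) + (\<phi> s - p s)) < r"
    using S2_inner_self_le[OF sq] \<phi>(2) r by simp
  moreover have "S2_inner (\<lambda>s. (u s - \<phi> s) + (\<phi> s - p s)) (\<lambda>s. (u s - \<phi> s) + (\<phi> s - p s))
     = S2_inner (\<lambda>s. u s - (\<Sum>i<?N. ?d i * harmonic i s)) (\<lambda>s. u s - (\<Sum>i<?N. ?d i * harmonic i s))"
    using harmonic_expansion[OF n] by (intro S2_inner_cong) simp_all
  ultimately have "S2_inner u u - (\<Sum>i<?N. (S2_inner u (harmonic i))\<^sup>2) < r"
    using S2_best_approximation[OF u, of ?N ?d] by simp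
  moreover have "(\<Sum>i<?N. (S2_inner u (harmonic i))\<^sup>2) \<le> (\<Sum>i<m. (S2_inner u (harmonic i))\<^sup>2)"
    if "m \<ge> ?N" for m
    using that by (intro sum_mono2) auto
  ultimately have "norm ((\<Sum>i<m. (S2_inner u (harmonic i))\<^sup>2) - S2_inner u u) < r" if "m \<ge> ?N" for m
    using S2_bessel[OF u, of m] that by fastforce
  then show "\<exists>no. \<forall>m\<ge>no. norm ((\<Sum>i<m. (S2_inner u (harmonic i))\<^sup>2) - S2_inner u u) < r"
    by blast
qed

text \<open>Let \<open>K\<close> be the sum in question and \<open>R\<close> a rotation with \<open>R s = t\<close>. The function \<open>y \<mapsto> \<Sum>\<^sub>i h\<^sub>i t * h\<^sub>i (R y)\<close> is a
polynomial of degree at most \<open>n\<close>, has the value \<open>K t\<close> at \<open>s\<close>, and by rotation invariance its squared norm is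
\<open>K t\<close>. Evaluation at \<open>s\<close> has squared norm \<open>K s\<close> on these polynomials, so \<open>(K t)\<^sup>2 \<le> K t * K s\<close>.\<close>

lemma harmonic_kernel_mono:
  assumes s: "s \<in> S2" and t: "t \<in> S2"
  shows "(\<Sum>i<(n + 1)\<^sup>2. (harmonic i t)\<^sup>2) \<le> (\<Sum>i<(n + 1)\<^sup>2. (harmonic i s)\<^sup>2)"
proof -
  let ?m = "(n + 1)\<^sup>2"
  define K where "K x = (\<Sum>i<?m. (harmonic i x)\<^sup>2)" for x
  obtain R where R: "orthogonal_transformation R" "R s = t"
    using orthogonal_transformation_exists_1[of s t] s t by auto
  define g where "g y = (\<Sum>i<?m. harmonic i t * harmonic i y)" for y
  define f where "f y = g (R y)" for y
  have g: "deg_le n g"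
    unfolding g_def[abs_def]
  proof (intro deg_le_sum deg_le_scale)
    fix i assume "i \<in> {..<?m}"
    then have "floor_sqrt i < n + 1" by (simp add: floor_sqrt_less_iff)
    then show "deg_le n (harmonic i)" using deg_le_mono[OF deg_le_harmonic] by simp
  qed auto
  then have f: "deg_le n f"
    unfolding f_def by (rule deg_le_rotation[OF R(1)])
  have sf: "sq_integrable f" and sg: "continuous_on S2 g"
    using f g by (auto intro: sq_integrable_continuous deg_le_continuous)
  have fs: "f s = K t" by (simp add: f_def R g_def K_def power2_eq_square)
  have "S2_inner f f = S2_inner g g"
    unfolding S2_inner_def f_def
    using surface_integral_rotation[OF R(1), of "\<lambda>y. g y * g y"] sg by (simp add: continuous_intros)
  also have "\<dots> = (\<Sum>i<?m. (harmonic i t)\<^sup>2 * S2_inner (harmonic i) (harmonic i))"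
    unfolding g_def[abs_def] S2_inner_harmonic_sums ..
  also have "\<dots> = K t"
    unfolding K_def using harmonic_norm_mult[of _ t]
    by (intro sum.cong) (simp_all add: power2_eq_square mult.assoc)
  finally have ff: "S2_inner f f = K t" .
  have "(K t)\<^sup>2 = (\<Sum>i<?m. S2_inner f (harmonic i) * harmonic i s)\<^sup>2"
    using harmonic_expansion[OF f s] fs by simp
  also have "\<dots> \<le> (\<Sum>i<?m. (S2_inner f (harmonic i))\<^sup>2) * K s"
    unfolding K_def by (rule Cauchy_Schwarz_ineq_sum)
  also have "\<dots> \<le> K t * K s"
    using S2_bessel[OF sf, of ?m] ff by (intro mult_right_mono) (auto simp: K_def sum_nonneg)
  finally have "K t * K t \<le> K t * K s" by (simp add: power2_eq_square)
  moreover have "K t \<ge> 0" "K s \<ge> 0" by (auto simp: K_def sum_nonneg)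
  ultimately have "K t \<le> K s" by (cases "K t = 0") (auto simp: mult_le_cancel_left)
  then show ?thesis by (simp add: K_def)
qed

text \<open>The sum does not depend on the point, and its integral counts the nonzero functions among the first \<open>n\<^sup>2\<close>.\<close>

lemma harmonic_kernel_le:
  assumes s: "s \<in> S2"
  shows "(\<Sum>i<n\<^sup>2. (harmonic i s)\<^sup>2) \<le> (real n)\<^sup>2 / (4 * pi)"
proof (cases n)
  case (Suc k)
  let ?K = "\<lambda>x. \<Sum>i<n\<^sup>2. (harmonic i x)\<^sup>2"
  have "4 * pi * ?K s = (\<integral>x. ?K s \<partial>surface_measure)"
    by (simp add: measure_surface_S2)
  also have "\<dots> \<le> (\<integral>x. ?K x \<partial>surface_measure)"
  proof (rule integral_mono_AE)
    show "integrable surface_measure ?K"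
      by (intro surface_integrable_continuous continuous_intros)
    show "AE x in surface_measure. ?K s \<le> ?K x"
      using harmonic_kernel_mono[OF _ s, of _ k] Suc by (intro AE_I2) simp
  qed simp
  also have "\<dots> = (\<Sum>i<n\<^sup>2. S2_inner (harmonic i) (harmonic i))"
    unfolding S2_inner_def power2_eq_square
    by (intro Bochner_Integration.integral_sum surface_integrable_continuous continuous_intros)
  also have "\<dots> \<le> (\<Sum>i<n\<^sup>2. 1)" by (intro sum_mono harmonic_norm_le)
  finally show ?thesis by (simp add: field_simps)
qed simp

lemma laplacian_green:
  assumes f: "deg_le n f" and g: "C1_on_S2 g"
  shows "S2_inner (spherical_laplacian f) g
    = - (\<Sum>k\<in>UNIV. S2_inner (angular (axis k 1) f) (angular (axis k 1) g))"
proof -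
  have "S2_inner (spherical_laplacian f) g
      = (\<Sum>k\<in>UNIV. S2_inner (angular (axis k 1) (angular (axis k 1) f)) g)"
    unfolding spherical_laplacian_def[abs_def]
    by (subst S2_inner_sum) (auto intro!: sq_integrable_continuous
      deg_le_continuous[OF deg_le_angular[OF deg_le_angular[OF f]]] C1_on_S2_continuous[OF g])
  also have "\<dots> = (\<Sum>k\<in>UNIV. - S2_inner (angular (axis k 1) f) (angular (axis k 1) g))"
    unfolding S2_inner_def
    by (intro sum.cong refl integral_angular_by_parts deg_le_C1[OF deg_le_angular[OF f]] g) simp
  finally show ?thesis by (simp add: sum_negf)
qed

lemma laplacian_symmetric:
  assumes f: "deg_le n f" and g: "deg_le m g"
  shows "S2_inner (spherical_laplacian f) g = S2_inner f (spherical_laplacian g)"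
  using laplacian_green[OF f deg_le_C1[OF g]] laplacian_green[OF g deg_le_C1[OF f]]
  by (simp add: S2_inner_commute)

lemma harmonic_orthogonal_lower_degree:
  assumes f: "deg_le n f" and i: "(n + 1)\<^sup>2 \<le> i"
  shows "S2_inner f (harmonic i) = 0"
proof -
  have "S2_inner f (harmonic i)
      = S2_inner (\<lambda>s. \<Sum>j<(n + 1)\<^sup>2. S2_inner f (harmonic j) * harmonic j s) (harmonic i)"
    using harmonic_expansion[OF f] by (intro S2_inner_cong) auto
  also have "\<dots> = (\<Sum>j<(n + 1)\<^sup>2. S2_inner f (harmonic j) * S2_inner (harmonic i) (harmonic j))"
    by (rule S2_inner_harmonic_sum_left[OF sq_integrable_harmonic])
  also have "\<dots> = 0" using i by (intro sum.neutral) (auto simp: harmonic_orthogonal)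
  finally show ?thesis .
qed

text \<open>The harmonics with indices from \<open>d\<^sup>2\<close> to \<open>(d + 1)\<^sup>2 - 1\<close> have degree \<open>d\<close>, which is the square root rounded down.\<close>

definition eigenvalue :: "nat \<Rightarrow> real" where
  "eigenvalue i = real (floor_sqrt i) * (real (floor_sqrt i) + 1)"

text \<open>If \<open>h\<close> has degree \<open>d\<close>, then \<open>g = \<Delta> h + d (d + 1) h\<close> has lower degree. For \<open>q\<close> of lower degree,
\<open>\<langle>g, q\<rangle> = \<langle>h, \<Delta> q\<rangle> + d (d + 1) \<langle>h, q\<rangle> = 0\<close>, because \<open>h\<close> is orthogonal to all lower degrees and \<open>\<Delta> q\<close>
has lower degree too. So \<open>g\<close> is orthogonal to itself.\<close>

lemma harmonic_eigenfunction:
  assumes s: "s \<in> S2"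
  shows "spherical_laplacian (harmonic i) s = - eigenvalue i * harmonic i s"
proof -
  define d where "d = floor_sqrt i"
  have hd: "deg_le d (harmonic i)" unfolding d_def by (rule deg_le_harmonic)
  obtain g where g: "deg_le (d - 1) g" "d = 0 \<longrightarrow> g = (\<lambda>x. 0)"
    "\<forall>s\<in>S2. spherical_laplacian (harmonic i) s = - (real d * (real d + 1)) * harmonic i s + g s"
    using spherical_laplacian_top_degree[OF hd] by blast
  have "g s = 0"
  proof (cases "d = 0")
    case False
    then have d: "d - 1 + 1 = d" by simp
    have "S2_inner g (harmonic j) = 0" if j: "j < d\<^sup>2" for j
    proof -
      have "floor_sqrt j < d" using j by (simp add: floor_sqrt_less_iff)
      then have "deg_le (d - 1) (harmonic j)"
        using deg_le_mono[OF deg_le_harmonic, of j "d - 1"] by simp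
      then have dl: "deg_le (d - 1) (spherical_laplacian (harmonic j))" by (rule deg_le_laplacian)
      have "d\<^sup>2 \<le> i" by (simp add: d_def)
      then have ij: "i \<noteq> j" using j by simp
      have "S2_inner g (harmonic j)
         = S2_inner (\<lambda>s. spherical_laplacian (harmonic i) s + (real d * (real d + 1)) * harmonic i s) (harmonic j)"
        using g(3) by (intro S2_inner_cong) auto
      also have "\<dots> = S2_inner (spherical_laplacian (harmonic i)) (harmonic j)
          + (real d * (real d + 1)) * S2_inner (harmonic i) (harmonic j)"
        by (subst S2_inner_add) (simp_all add: sq_intros sq_integrable_continuous
            deg_le_continuous[OF deg_le_laplacian[OF hd]] S2_inner_scale)
      also have "\<dots> = S2_inner (spherical_laplacian (harmonic j)) (harmonic i)"
        using laplacian_symmetric[OF hd deg_le_harmonic[of j]] harmonic_orthogonal[OF ij]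
        by (simp add: S2_inner_commute)
      also have "\<dots> = 0"
        using harmonic_orthogonal_lower_degree[OF dl, of i] \<open>d\<^sup>2 \<le> i\<close> d by simp
      finally show ?thesis .
    qed
    then show ?thesis
      using harmonic_expansion[OF g(1) s] d by simp
  qed (use g(2) in simp)
  then show ?thesis
    using g(3) s by (simp add: eigenvalue_def d_def)
qed

text \<open>Bessel's inequality for the tangential gradients of the harmonics, which are orthogonal and whose
squared norms are the eigenvalues unless the harmonic is zero. The family \<open>G\<close> stands for the three components of the gradient of \<open>u\<close> along
the rotation fields, and the last hypothesis is Green's formula.\<close>

lemma gradient_bessel:
  fixes G :: "3 \<Rightarrow> real^3 \<Rightarrow> real"
  assumes u: "sq_integrable u" and G: "\<And>k. sq_integrable (G k)"
    and green: "\<And>i. (\<Sum>k\<in>UNIV. S2_inner (G k) (angular (axis k 1) (harmonic i)))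
       = - S2_inner u (spherical_laplacian (harmonic i))"
  shows "(\<Sum>i<m. eigenvalue i * (S2_inner u (harmonic i))\<^sup>2) \<le> (\<Sum>k\<in>UNIV. S2_inner (G k) (G k))"
proof -
  let ?c = "\<lambda>i. S2_inner u (harmonic i)"
  let ?T = "\<lambda>k i. angular (axis k 1) (harmonic i)"
  define p where "p k s = (\<Sum>i<m. ?c i * ?T k i s)" for k s
  have T: "sq_integrable (?T k i)" for k i
    by (rule sq_integrable_continuous[OF deg_le_continuous[OF deg_le_angular[OF deg_le_harmonic]]])
  have p: "sq_integrable (p k)" for k
    unfolding p_def[abs_def] by (intro sq_intros T)
  have lap: "S2_inner v (spherical_laplacian (harmonic i)) = - eigenvalue i * S2_inner v (harmonic i)" for v i
  proof -
    have "S2_inner v (spherical_laplacian (harmonic i)) = S2_inner v (\<lambda>s. - eigenvalue i * harmonic i s)"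
      using harmonic_eigenfunction by (intro S2_inner_cong) auto
    then show ?thesis by (simp only: S2_inner_scale_right)
  qed
  have TT: "(\<Sum>k\<in>UNIV. S2_inner (?T k i) (?T k j)) = (if i = j then eigenvalue i * S2_inner (harmonic i) (harmonic i) else 0)" for i j
    using laplacian_green[OF deg_le_harmonic[of i] deg_le_C1[OF deg_le_harmonic[of j]]]
      lap[of "harmonic j" i] harmonic_orthogonal[of i j]
    by (auto simp: S2_inner_commute)
  have Gp: "(\<Sum>k\<in>UNIV. S2_inner (G k) (p k)) = (\<Sum>i<m. eigenvalue i * (?c i)\<^sup>2)"
  proof -
    have "(\<Sum>k\<in>UNIV. S2_inner (G k) (p k)) = (\<Sum>k\<in>UNIV. \<Sum>i<m. ?c i * S2_inner (G k) (?T k i))"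
    proof (intro sum.cong refl)
      fix k
      have "S2_inner (G k) (p k) = S2_inner (p k) (G k)" by (rule S2_inner_commute)
      also have "\<dots> = (\<Sum>i<m. ?c i * S2_inner (?T k i) (G k))"
        unfolding p_def[abs_def] by (subst S2_inner_sum) (auto intro!: sq_intros T G simp: S2_inner_scale)
      also have "\<dots> = (\<Sum>i<m. ?c i * S2_inner (G k) (?T k i))"
        by (intro sum.cong refl arg_cong2[where f = "(*)"] S2_inner_commute)
      finally show "S2_inner (G k) (p k) = (\<Sum>i<m. ?c i * S2_inner (G k) (?T k i))" .
    qed
    also have "\<dots> = (\<Sum>i<m. ?c i * (\<Sum>k\<in>UNIV. S2_inner (G k) (?T k i)))"
      by (subst sum.swap) (simp add: sum_distrib_left)
    also have "\<dots> = (\<Sum>i<m. eigenvalue i * (?c i)\<^sup>2)"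
      by (intro sum.cong refl) (simp add: green lap power2_eq_square)
    finally show ?thesis .
  qed
  have pp: "(\<Sum>k\<in>UNIV. S2_inner (p k) (p k)) = (\<Sum>i<m. eigenvalue i * (?c i)\<^sup>2)"
  proof -
    have pT: "S2_inner (p k) (?T k j) = (\<Sum>i<m. ?c i * S2_inner (?T k i) (?T k j))" for k j
      unfolding p_def[abs_def] by (subst S2_inner_sum) (auto intro!: sq_intros T simp: S2_inner_scale)
    have "(\<Sum>k\<in>UNIV. S2_inner (p k) (p k)) = (\<Sum>k\<in>UNIV. \<Sum>j<m. ?c j * S2_inner (p k) (?T k j))"
    proof (intro sum.cong refl)
      fix k
      have "S2_inner (p k) (p k) = (\<Sum>j<m. ?c j * S2_inner (?T k j) (p k))"
        by (subst (1) p_def[abs_def], subst S2_inner_sum) (auto intro!: sq_intros T p simp: S2_inner_scale)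
      also have "\<dots> = (\<Sum>j<m. ?c j * S2_inner (p k) (?T k j))"
        by (intro sum.cong refl arg_cong2[where f = "(*)"] S2_inner_commute)
      finally show "S2_inner (p k) (p k) = (\<Sum>j<m. ?c j * S2_inner (p k) (?T k j))" .
    qed
    also have "\<dots> = (\<Sum>j<m. \<Sum>i<m. ?c j * ?c i * (\<Sum>k\<in>UNIV. S2_inner (?T k i) (?T k j)))"
      unfolding pT sum_distrib_left
      by (subst sum.swap) (intro sum.cong refl, subst sum.swap, simp add: mult.assoc)
    also have "\<dots> = (\<Sum>j<m. \<Sum>i<m. if i = j then ?c j * ?c j * (eigenvalue j * S2_inner (harmonic j) (harmonic j)) else 0)"
      by (intro sum.cong refl) (simp add: TT)
    also have "\<dots> = (\<Sum>j<m. eigenvalue j * (?c j)\<^sup>2)"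
    proof (intro sum.cong refl)
      fix j assume "j \<in> {..<m}"
      then have "(\<Sum>i<m. if i = j then ?c j * ?c j * (eigenvalue j * S2_inner (harmonic j) (harmonic j)) else 0)
        = eigenvalue j * (?c j * (?c j * S2_inner (harmonic j) (harmonic j)))" by simp
      then show "(\<Sum>i<m. if i = j then ?c j * ?c j * (eigenvalue j * S2_inner (harmonic j) (harmonic j)) else 0)
        = eigenvalue j * (?c j)\<^sup>2"
        by (simp only: coefficient_norm_mult power2_eq_square)
    qed
    finally show ?thesis .
  qed
  have "0 \<le> (\<Sum>k\<in>UNIV. S2_inner (\<lambda>s. G k s - p k s) (\<lambda>s. G k s - p k s))"
    by (intro sum_nonneg S2_inner_self_nonneg)
  also have "\<dots> = (\<Sum>k\<in>UNIV. S2_inner (G k) (G k) - 2 * S2_inner (G k) (p k) + S2_inner (p k) (p k))"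
  proof (intro sum.cong refl)
    fix k
    have "S2_inner (\<lambda>s. G k s - p k s) (\<lambda>s. G k s - p k s)
      = (S2_inner (G k) (G k) - S2_inner (p k) (G k)) - (S2_inner (G k) (p k) - S2_inner (p k) (p k))"
      by (simp only: S2_inner_diff[OF G p sq_integrable_diff[OF G p]]
          S2_inner_commute[of "G k" "\<lambda>s. G k s - p k s"] S2_inner_commute[of "p k" "\<lambda>s. G k s - p k s"]
          S2_inner_diff[OF G p G] S2_inner_diff[OF G p p])
    then show "S2_inner (\<lambda>s. G k s - p k s) (\<lambda>s. G k s - p k s)
      = S2_inner (G k) (G k) - 2 * S2_inner (G k) (p k) + S2_inner (p k) (p k)"
      by (simp add: S2_inner_commute[of "p k" "G k"])
  qed
  also have "\<dots> = (\<Sum>k\<in>UNIV. S2_inner (G k) (G k)) - (\<Sum>i<m. eigenvalue i * (?c i)\<^sup>2)"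
    by (simp add: sum.distrib sum_subtractf pp Gp flip: sum_distrib_left)
  finally show ?thesis by simp
qed

section \<open>Density estimates in the manner of Rumin\<close>

text \<open>The coefficient at index \<open>i\<close> occurs in the tails with \<open>n\<^sup>2 \<le> i\<close>, that is \<open>n \<le> d\<close> with \<open>d = floor_sqrt i\<close>, so it is
counted with total weight at most \<open>\<Sum>\<^sub>n\<^sub>\<le>\<^sub>d 2 n = d (d + 1)\<close>, which is the eigenvalue.\<close>

lemma weighted_spectral_tails_le:
  fixes c :: "nat \<Rightarrow> real"
  assumes energy: "\<And>m. (\<Sum>i<m. eigenvalue i * (c i)\<^sup>2) \<le> T"
    and parseval: "(\<lambda>m. \<Sum>i<m. (c i)\<^sup>2) \<longlonglongrightarrow> q"
  shows "(\<Sum>n=1..M. 2 * real n * (q - (\<Sum>i<n\<^sup>2. (c i)\<^sup>2))) \<le> T"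
proof (rule LIMSEQ_le_const2)
  show "(\<lambda>m. \<Sum>n=1..M. 2 * real n * ((\<Sum>i<m. (c i)\<^sup>2) - (\<Sum>i<n\<^sup>2. (c i)\<^sup>2)))
      \<longlonglongrightarrow> (\<Sum>n=1..M. 2 * real n * (q - (\<Sum>i<n\<^sup>2. (c i)\<^sup>2)))"
    by (intro tendsto_intros parseval)
  have weight: "(\<Sum>n=1..M. if n\<^sup>2 \<le> i then 2 * real n else 0) \<le> eigenvalue i" for i
  proof -
    have "(\<Sum>n=1..M. if n\<^sup>2 \<le> i then 2 * real n else 0) = (\<Sum>n\<in>{n\<in>{1..M}. n\<^sup>2 \<le> i}. 2 * real n)"
      by (rule sum.inter_filter[symmetric]) simp
    also have "\<dots> \<le> (\<Sum>n\<in>{1..floor_sqrt i}. 2 * real n)"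
      by (intro sum_mono2) (auto simp: le_floor_sqrt_iff)
    also have "(\<Sum>n\<in>{1..d}. 2 * real n) = real d * (real d + 1)" for d
      by (induction d) (simp_all add: algebra_simps)
    finally show ?thesis by (simp add: eigenvalue_def)
  qed
  have "(\<Sum>n=1..M. 2 * real n * ((\<Sum>i<m. (c i)\<^sup>2) - (\<Sum>i<n\<^sup>2. (c i)\<^sup>2))) \<le> T" if m: "m \<ge> M\<^sup>2" for m
  proof -
    have "(\<Sum>n=1..M. 2 * real n * ((\<Sum>i<m. (c i)\<^sup>2) - (\<Sum>i<n\<^sup>2. (c i)\<^sup>2)))
        = (\<Sum>n=1..M. \<Sum>i<m. (if n\<^sup>2 \<le> i then 2 * real n else 0) * (c i)\<^sup>2)"
    proof (intro sum.cong refl)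
      fix n assume "n \<in> {1..M}"
      then have "n\<^sup>2 \<le> m" using m power_mono[of n M 2] by (meson atLeastAtMost_iff le0 order_trans)
      then have "(\<Sum>i<m. (c i)\<^sup>2) - (\<Sum>i<n\<^sup>2. (c i)\<^sup>2) = (\<Sum>i\<in>{..<m} - {..<n\<^sup>2}. (c i)\<^sup>2)"
        by (intro sum_diff[symmetric]) auto
      also have "\<dots> = (\<Sum>i\<in>{i\<in>{..<m}. n\<^sup>2 \<le> i}. (c i)\<^sup>2)"
        by (intro sum.cong) auto
      also have "\<dots> = (\<Sum>i<m. if n\<^sup>2 \<le> i then (c i)\<^sup>2 else 0)"
        by (rule sum.inter_filter) simp
      finally have eq: "(\<Sum>i<m. (c i)\<^sup>2) - (\<Sum>i<n\<^sup>2. (c i)\<^sup>2) = (\<Sum>i<m. if n\<^sup>2 \<le> i then (c i)\<^sup>2 else 0)" .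
      show "2 * real n * ((\<Sum>i<m. (c i)\<^sup>2) - (\<Sum>i<n\<^sup>2. (c i)\<^sup>2))
          = (\<Sum>i<m. (if n\<^sup>2 \<le> i then 2 * real n else 0) * (c i)\<^sup>2)"
        unfolding eq sum_distrib_left by (intro sum.cong refl) simp
    qed
    also have "\<dots> = (\<Sum>i<m. (\<Sum>n=1..M. if n\<^sup>2 \<le> i then 2 * real n else 0) * (c i)\<^sup>2)"
      by (subst sum.swap) (simp add: sum_distrib_right)
    also have "\<dots> \<le> (\<Sum>i<m. eigenvalue i * (c i)\<^sup>2)"
      by (intro sum_mono mult_right_mono weight) simp
    also have "\<dots> \<le> T" by (rule energy)
    finally show ?thesis .
  qed
  then show "\<exists>N. \<forall>n\<ge>N. (\<Sum>na=1..M. 2 * real na * ((\<Sum>i<n. (c i)\<^sup>2) - (\<Sum>i<na\<^sup>2. (c i)\<^sup>2))) \<le> T"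
    by blast
qed

lemma sum_weighted_squares_closed_form:
  "(\<Sum>n=1..m. 2 * real n * (x - real n)\<^sup>2)
    = x\<^sup>2 * (real m * (real m + 1)) - 2 * x * (real m * (real m + 1) * (2 * real m + 1) / 3)
      + (real m)\<^sup>2 * (real m + 1)\<^sup>2 / 2"
  by (induction m) (simp_all add: algebra_simps power2_eq_square add_divide_distrib)

text \<open>Write \<open>y = m + t\<close> with an integer \<open>m\<close> and \<open>0 \<le> t \<le> 1\<close>. Only \<open>n \<le> m\<close> contribute to the sum, its closed form is
\<open>(m\<^sup>4 - m\<^sup>2) / 6\<close> plus terms in \<open>t\<close>, and with the term \<open>(2/3) y\<^sup>2\<close> all the remaining
coefficients combine to something nonnegative.\<close>

lemma quartic_staircase_bound_aux:
  assumes y: "0 \<le> y" "y \<le> real M"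
  shows "y ^ 4 / 6 \<le> 2 / 3 * y\<^sup>2 + (\<Sum>n=1..M. 2 * real n * (max 0 (y - real n))\<^sup>2)"
proof -
  define m where "m = nat \<lfloor>y\<rfloor>"
  define t where "t = y - real m"
  have t: "0 \<le> t" "t \<le> 1" using y unfolding t_def m_def by linarith+
  have mM: "m \<le> M" using y unfolding m_def by linarith
  have yt: "y = real m + t" by (simp add: t_def)
  have "0 \<le> 3 * (real m)\<^sup>2 + 6 * (t\<^sup>2 * real m) + 4 * (real m * t) * (1 - t\<^sup>2) + t\<^sup>2 * (4 - t\<^sup>2)"
  proof -
    have "t\<^sup>2 \<le> 1" using t by (simp add: power_le_one)
    then show ?thesis using t by (intro add_nonneg_nonneg mult_nonneg_nonneg) auto
  qed
  also have "\<dots> = 6 * (2 / 3 * y\<^sup>2 + (\<Sum>n=1..m. 2 * real n * (y - real n)\<^sup>2)) - y ^ 4"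
    unfolding sum_weighted_squares_closed_form yt
    by (simp add: field_simps power2_eq_square power4_eq_xxxx)
  finally have "y ^ 4 / 6 \<le> 2 / 3 * y\<^sup>2 + (\<Sum>n=1..m. 2 * real n * (y - real n)\<^sup>2)" by simp
  also have "(\<Sum>n=1..m. 2 * real n * (y - real n)\<^sup>2) = (\<Sum>n=1..m. 2 * real n * (max 0 (y - real n))\<^sup>2)"
    using t yt by (intro sum.cong refl) simp
  also have "\<dots> \<le> (\<Sum>n=1..M. 2 * real n * (max 0 (y - real n))\<^sup>2)"
    using mM by (intro sum_mono2) auto
  finally show ?thesis by simp
qed

text \<open>Truncation at \<open>M\<close> keeps the sum finite: the right hand side is increasing in \<open>y\<close>, so beyond \<open>M\<close> its value at
\<open>M\<close> suffices.\<close>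

lemma quartic_staircase_bound:
  assumes y: "0 \<le> y"
  shows "(min y (real M)) ^ 4 / 6 \<le> 2 / 3 * y\<^sup>2 + (\<Sum>n=1..M. 2 * real n * (max 0 (y - real n))\<^sup>2)"
proof -
  let ?z = "min y (real M)"
  have z: "0 \<le> ?z" "?z \<le> real M" "?z \<le> y" using y by auto
  have "?z ^ 4 / 6 \<le> 2 / 3 * ?z\<^sup>2 + (\<Sum>n=1..M. 2 * real n * (max 0 (?z - real n))\<^sup>2)"
    by (rule quartic_staircase_bound_aux[OF z(1,2)])
  also have "\<dots> \<le> 2 / 3 * y\<^sup>2 + (\<Sum>n=1..M. 2 * real n * (max 0 (y - real n))\<^sup>2)"
    using z by (intro add_mono mult_left_mono power_mono sum_mono) auto
  finally show ?thesis .
qed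

lemma orthonormal_bessel:
  assumes u: "\<And>j. j \<in> J \<Longrightarrow> sq_integrable (u j)" and J: "finite J"
    and orth: "\<And>i j. i \<in> J \<Longrightarrow> j \<in> J \<Longrightarrow> S2_inner (u i) (u j) = (if i = j then 1 else 0)"
    and k: "sq_integrable k"
  shows "(\<Sum>j\<in>J. (S2_inner k (u j))\<^sup>2) \<le> S2_inner k k"
proof -
  define b where "b j = S2_inner k (u j)" for j
  define p where "p s = (\<Sum>j\<in>J. b j * u j s)" for s
  have p: "sq_integrable p"
    unfolding p_def[abs_def] by (intro sq_intros u)
  have left: "S2_inner p v = (\<Sum>j\<in>J. b j * S2_inner (u j) v)" if "sq_integrable v" for v
    unfolding p_def[abs_def] by (subst S2_inner_sum) (auto intro!: sq_intros u that simp: S2_inner_scale)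
  have pk: "S2_inner p k = (\<Sum>j\<in>J. (b j)\<^sup>2)"
    unfolding left[OF k] by (intro sum.cong refl) (simp add: b_def power2_eq_square S2_inner_commute[of _ k])
  have up: "S2_inner (u j) p = b j" if j: "j \<in> J" for j
  proof -
    have "S2_inner (u j) p = (\<Sum>i\<in>J. b i * S2_inner (u i) (u j))"
      using left[OF u[OF j]] by (simp add: S2_inner_commute[of "u j" p])
    also have "\<dots> = (\<Sum>i\<in>J. if i = j then b i else 0)"
      using j by (intro sum.cong refl) (simp add: orth)
    finally show ?thesis using j J by simp
  qed
  have pp: "S2_inner p p = (\<Sum>j\<in>J. (b j)\<^sup>2)"
    unfolding left[OF p] by (intro sum.cong refl) (simp add: up power2_eq_square)
  have "0 \<le> S2_inner (\<lambda>s. k s - p s) (\<lambda>s. k s - p s)" by (rule S2_inner_self_nonneg)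
  also have "\<dots> = (S2_inner k k - S2_inner p k) - (S2_inner k p - S2_inner p p)"
    by (simp only: S2_inner_diff[OF k p sq_integrable_diff[OF k p]]
        S2_inner_commute[of k "\<lambda>s. k s - p s"] S2_inner_commute[of p "\<lambda>s. k s - p s"]
        S2_inner_diff[OF k p k] S2_inner_diff[OF k p p])
  finally show ?thesis
    unfolding S2_inner_commute[of k p] pk pp by (simp add: b_def)
qed

abbreviation low_degree_part :: "nat \<Rightarrow> (real^3 \<Rightarrow> real) \<Rightarrow> real^3 \<Rightarrow> real" where
  "low_degree_part n u s \<equiv> (\<Sum>i<n\<^sup>2. S2_inner u (harmonic i) * harmonic i s)"

text \<open>At a fixed point \<open>s\<close>, the values of the low degree parts are the inner products of the \<open>u j\<close> with the
reproducing kernel at \<open>s\<close>, whose squared norm is its value on the diagonal.\<close>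

lemma low_degree_density_le:
  assumes u: "\<And>j. j \<in> J \<Longrightarrow> sq_integrable (u j)" and J: "finite J"
    and orth: "\<And>i j. i \<in> J \<Longrightarrow> j \<in> J \<Longrightarrow> S2_inner (u i) (u j) = (if i = j then 1 else 0)"
    and s: "s \<in> S2"
  shows "(\<Sum>j\<in>J. (low_degree_part n (u j) s)\<^sup>2) \<le> (real n)\<^sup>2 / (4 * pi)"
proof -
  \<comment> \<open>The reproducing kernel at \<open>s\<close>.\<close>
  define k where "k y = (\<Sum>i<n\<^sup>2. harmonic i s * harmonic i y)" for y
  have k: "sq_integrable k" unfolding k_def[abs_def] by (intro sq_intros)
  have "(\<Sum>j\<in>J. (low_degree_part n (u j) s)\<^sup>2) = (\<Sum>j\<in>J. (S2_inner k (u j))\<^sup>2)"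
    unfolding k_def[abs_def]
    by (intro sum.cong refl, subst S2_inner_harmonic_sum_left[OF u]) (simp_all add: mult.commute)
  also have "\<dots> \<le> S2_inner k k" by (rule orthonormal_bessel[OF u J orth k])
  also have "\<dots> = (\<Sum>i<n\<^sup>2. (harmonic i s)\<^sup>2)"
    unfolding k_def[abs_def] S2_inner_harmonic_sums using harmonic_norm_mult[of _ s]
    by (intro sum.cong) (simp_all add: power2_eq_square mult.assoc)
  also have "\<dots> \<le> (real n)\<^sup>2 / (4 * pi)" by (rule harmonic_kernel_le[OF s])
  finally show ?thesis .
qed

text \<open>The triangle inequality for the vectors indexed by \<open>J\<close>, at a fixed point \<open>s\<close>.\<close>

lemma high_degree_density_ge:
  assumes u: "\<And>j. j \<in> J \<Longrightarrow> sq_integrable (u j)" and J: "finite J"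
    and orth: "\<And>i j. i \<in> J \<Longrightarrow> j \<in> J \<Longrightarrow> S2_inner (u i) (u j) = (if i = j then 1 else 0)"
    and s: "s \<in> S2"
  shows "(max 0 (sqrt (4 * pi * (\<Sum>j\<in>J. (u j s)\<^sup>2)) - real n))\<^sup>2
    \<le> 4 * pi * (\<Sum>j\<in>J. (u j s - low_degree_part n (u j) s)\<^sup>2)"
proof -
  let ?H = "\<lambda>j. u j s - low_degree_part n (u j) s" and ?L = "\<lambda>j. low_degree_part n (u j) s"
  have "L2_set (\<lambda>j. u j s) J \<le> L2_set ?H J + L2_set ?L J"
    using L2_set_triangle_ineq[of ?H ?L J] by simp
  then have "sqrt (4 * pi) * L2_set (\<lambda>j. u j s) J \<le> sqrt (4 * pi) * L2_set ?H J + sqrt (4 * pi) * L2_set ?L J"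
    by (simp flip: distrib_left)
  moreover have "sqrt (4 * pi) * L2_set ?L J \<le> real n"
  proof -
    have "4 * pi * (\<Sum>j\<in>J. (?L j)\<^sup>2) \<le> (real n)\<^sup>2"
      using low_degree_density_le[OF u J orth s, of n] by (simp add: field_simps)
    then have "sqrt (4 * pi * (\<Sum>j\<in>J. (?L j)\<^sup>2)) \<le> real n"
      by (intro real_le_lsqrt) simp_all
    then show ?thesis by (simp add: L2_set_def real_sqrt_mult)
  qed
  ultimately have "sqrt (4 * pi * (\<Sum>j\<in>J. (u j s)\<^sup>2)) - real n \<le> sqrt (4 * pi) * L2_set ?H J"
    by (simp add: L2_set_def real_sqrt_mult)
  then have "(max 0 (sqrt (4 * pi * (\<Sum>j\<in>J. (u j s)\<^sup>2)) - real n))\<^sup>2 \<le> (sqrt (4 * pi) * L2_set ?H J)\<^sup>2"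
    by (intro power_mono) (auto simp: L2_set_nonneg)
  also have "\<dots> = 4 * pi * (\<Sum>j\<in>J. (?H j)\<^sup>2)"
    by (simp add: power_mult_distrib L2_set_def sum_nonneg)
  finally show ?thesis .
qed

text \<open>The staircase inequality, with \<open>y\<^sup>2 = 4 \<pi> \<rho>\<close>, is applied at every point and integrated; the truncation is
then removed by monotone convergence. The hypothesis on the tails is the only place where the energy enters.\<close>

lemma lieb_thirring_sphere:
  fixes u :: "'j \<Rightarrow> real^3 \<Rightarrow> real"
  assumes u: "\<And>j. j \<in> J \<Longrightarrow> sq_integrable (u j)" and J: "finite J"
    and orth: "\<And>i j. i \<in> J \<Longrightarrow> j \<in> J \<Longrightarrow> S2_inner (u i) (u j) = (if i = j then 1 else 0)"
    and tails: "\<And>j M. j \<in> J \<Longrightarrow>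
      (\<Sum>n=1..M. 2 * real n * (1 - (\<Sum>i<n\<^sup>2. (S2_inner (u j) (harmonic i))\<^sup>2))) \<le> T j"
  shows "(\<integral>\<^sup>+ s. ennreal ((\<Sum>j\<in>J. (u j s)\<^sup>2)\<^sup>2) \<partial>surface_measure)
    \<le> ennreal (real (card J) / pi + 3 / (2 * pi) * (\<Sum>j\<in>J. T j))"
proof -
  define \<rho> where "\<rho> s = (\<Sum>j\<in>J. (u j s)\<^sup>2)" for s
  define y where "y s = sqrt (4 * pi * \<rho> s)" for s
  define B where "B = 16 * pi * real (card J) + 24 * pi * (\<Sum>j\<in>J. T j)"
  have \<rho>0: "\<rho> s \<ge> 0" for s by (simp add: \<rho>_def sum_nonneg)
  then have y0: "y s \<ge> 0" and y2: "(y s)\<^sup>2 = 4 * pi * \<rho> s" for s by (simp_all add: y_def)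
  have y4: "(y s) ^ 4 = 16 * pi\<^sup>2 * (\<rho> s)\<^sup>2" for s
    using y2[of s] by (simp add: power4_eq_xxxx power2_eq_square)
  have um: "u j \<in> borel_measurable surface_measure" if "j \<in> J" for j
    using u[OF that] by (simp add: sq_integrable_def)
  have \<rho>m: "\<rho> \<in> borel_measurable surface_measure"
    unfolding \<rho>_def[abs_def] using um by (intro borel_measurable_sum borel_measurable_power)
  then have ym [measurable]: "y \<in> borel_measurable surface_measure"
    unfolding y_def[abs_def] by measurable
  define r where "r j n s = u j s - low_degree_part n (u j) s" for j n s
  have r: "sq_integrable (r j n)" if "j \<in> J" for j n
    unfolding r_def[abs_def] by (intro sq_intros u that)
  have r_int: "(\<integral>s. (r j n s)\<^sup>2 \<partial>surface_measure) = 1 - (\<Sum>i<n\<^sup>2. (S2_inner (u j) (harmonic i))\<^sup>2)" if "j \<in> J" for j n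
    using S2_projection_residual[OF u[OF that], of "n\<^sup>2"] orth[OF that that]
    by (simp add: r_def[abs_def] S2_inner_def power2_eq_square)
  \<comment> \<open>An integrable majorant of \<open>(min y M)\<^sup>4 / 6\<close> whose integral the spectral tails control.\<close>
  define F where "F M s = 2 / 3 * (4 * pi * \<rho> s) + (\<Sum>n=1..M. 2 * real n * (4 * pi * (\<Sum>j\<in>J. (r j n s)\<^sup>2)))" for M :: nat and s
  have F_integrable: "integrable surface_measure (F M)" for M
    unfolding F_def[abs_def] \<rho>_def
    using u r by (intro Bochner_Integration.integrable_add integrable_mult_right Bochner_Integration.integrable_sum)
      (auto simp: sq_integrable_def)
  have F_integral: "6 * (\<integral>s. F M s \<partial>surface_measure) \<le> B" for M
  proof -
    have "(\<integral>s. F M s \<partial>surface_measure) = 2 / 3 * (4 * pi * (\<Sum>j\<in>J. \<integral>s. (u j s)\<^sup>2 \<partial>surface_measure))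
      + (\<Sum>n=1..M. 2 * real n * (4 * pi * (\<Sum>j\<in>J. \<integral>s. (r j n s)\<^sup>2 \<partial>surface_measure)))"
      unfolding F_def \<rho>_def using u r
      by (subst Bochner_Integration.integral_add Bochner_Integration.integral_sum
           | (intro Bochner_Integration.integrable_add integrable_mult_right Bochner_Integration.integrable_sum;
              auto simp: sq_integrable_def; fail)
           | simp add: sq_integrable_def)+
    also have "(\<Sum>j\<in>J. \<integral>s. (u j s)\<^sup>2 \<partial>surface_measure) = real (card J)"
      using orth by (simp add: S2_inner_def power2_eq_square)
    also have "(\<Sum>n=1..M. 2 * real n * (4 * pi * (\<Sum>j\<in>J. \<integral>s. (r j n s)\<^sup>2 \<partial>surface_measure)))
      = 4 * pi * (\<Sum>j\<in>J. \<Sum>n=1..M. 2 * real n * (1 - (\<Sum>i<n\<^sup>2. (S2_inner (u j) (harmonic i))\<^sup>2)))"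
      unfolding sum_distrib_left by (subst sum.swap) (auto intro!: sum.cong simp: r_int)
    also have "\<dots> \<le> 4 * pi * (\<Sum>j\<in>J. T j)"
      using tails by (intro mult_left_mono sum_mono) auto
    finally show ?thesis by (simp add: B_def)
  qed
  have trunc: "(\<integral>\<^sup>+ s. ennreal ((min (y s) (real M)) ^ 4) \<partial>surface_measure) \<le> ennreal B" for M
  proof -
    have "(\<integral>\<^sup>+ s. ennreal ((min (y s) (real M)) ^ 4) \<partial>surface_measure)
        \<le> (\<integral>\<^sup>+ s. ennreal (6 * F M s) \<partial>surface_measure)"
    proof (rule nn_integral_mono)
      fix s assume "s \<in> space surface_measure"
      then have s: "s \<in> S2" by simp
      have "(min (y s) (real M)) ^ 4 / 6 \<le> 2 / 3 * (y s)\<^sup>2 + (\<Sum>n=1..M. 2 * real n * (max 0 (y s - real n))\<^sup>2)"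
        by (rule quartic_staircase_bound[OF y0])
      also have "\<dots> \<le> F M s"
        unfolding F_def y2 using high_degree_density_ge[OF u J orth s]
        by (intro add_left_mono sum_mono mult_left_mono) (auto simp: y_def \<rho>_def r_def)
      finally show "ennreal ((min (y s) (real M)) ^ 4) \<le> ennreal (6 * F M s)"
        by (intro ennreal_leI) simp
    qed
    also have "(\<integral>\<^sup>+ s. ennreal (6 * F M s) \<partial>surface_measure) = ennreal (\<integral>s. 6 * F M s \<partial>surface_measure)"
    proof -
      have "F M s \<ge> 0" for s
        using \<rho>0[of s] unfolding F_def by (intro add_nonneg_nonneg sum_nonneg mult_nonneg_nonneg) auto
      then show ?thesis
        using F_integrable[of M] by (intro nn_integral_eq_integral AE_I2) auto
    qed
    also have "\<dots> \<le> ennreal B"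
      using F_integral[of M] by (intro ennreal_leI) simp
    finally show ?thesis .
  qed
  have "(\<integral>\<^sup>+ s. ennreal ((y s) ^ 4) \<partial>surface_measure)
      = (\<integral>\<^sup>+ s. (SUP M. ennreal ((min (y s) (real M)) ^ 4)) \<partial>surface_measure)"
  proof (rule nn_integral_cong)
    fix s
    show "ennreal ((y s) ^ 4) = (SUP M. ennreal ((min (y s) (real M)) ^ 4))"
    proof (rule antisym)
      have "min (y s) (real (nat \<lceil>y s\<rceil>)) = y s" by (simp add: min_absorb1 real_nat_ceiling_ge)
      then show "ennreal ((y s) ^ 4) \<le> (SUP M. ennreal ((min (y s) (real M)) ^ 4))"
        by (intro SUP_upper2[of "nat \<lceil>y s\<rceil>"]) auto
      show "(SUP M. ennreal ((min (y s) (real M)) ^ 4)) \<le> ennreal ((y s) ^ 4)"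
        using y0[of s] by (intro SUP_least ennreal_leI power_mono) auto
    qed
  qed
  also have "\<dots> = (SUP M. \<integral>\<^sup>+ s. ennreal ((min (y s) (real M)) ^ 4) \<partial>surface_measure)"
  proof (rule nn_integral_monotone_convergence_SUP)
    show "incseq (\<lambda>M s. ennreal ((min (y s) (real M)) ^ 4))"
      using y0 by (auto simp: incseq_def le_fun_def intro!: ennreal_leI power_mono)
  qed measurable
  also have "\<dots> \<le> ennreal B" using trunc by (intro SUP_least)
  finally have main: "(\<integral>\<^sup>+ s. ennreal ((y s) ^ 4) \<partial>surface_measure) \<le> ennreal B" .
  have "(\<integral>\<^sup>+ s. ennreal ((\<rho> s)\<^sup>2) \<partial>surface_measure)
      = (\<integral>\<^sup>+ s. ennreal (1 / (16 * pi\<^sup>2)) * ennreal ((y s) ^ 4) \<partial>surface_measure)"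
    by (intro nn_integral_cong) (simp add: y4 flip: ennreal_mult')
  also have "\<dots> = ennreal (1 / (16 * pi\<^sup>2)) * (\<integral>\<^sup>+ s. ennreal ((y s) ^ 4) \<partial>surface_measure)"
    by (rule nn_integral_cmult) measurable
  also have "\<dots> \<le> ennreal (1 / (16 * pi\<^sup>2)) * ennreal B"
    by (intro mult_left_mono main) simp
  also have "\<dots> = ennreal (real (card J) / pi + 3 / (2 * pi) * (\<Sum>j\<in>J. T j))"
  proof -
    have "1 / (16 * pi\<^sup>2) * B = real (card J) / pi + 3 / (2 * pi) * (\<Sum>j\<in>J. T j)"
      by (simp add: B_def divide_simps power2_eq_square) (simp add: algebra_simps)
    then show ?thesis by (simp flip: ennreal_mult')
  qed
  finally show ?thesis by (simp add: \<rho>_def)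
qed

lemma deg_le_0_const:
  assumes "deg_le 0 f"
  shows "\<exists>c. f = (\<lambda>x. c)"
  using assms
proof (induction "0::nat" f rule: deg_le.induct)
  case (add f g)
  then show ?case by force
qed auto

lemma S2_cauchy_schwarz:
  assumes f: "sq_integrable f" and g: "sq_integrable g"
  shows "(S2_inner f g)\<^sup>2 \<le> S2_inner f f * S2_inner g g"
proof -
  have expand: "0 \<le> S2_inner f f - 2 * t * S2_inner f g + t\<^sup>2 * S2_inner g g" for t
  proof -
    let ?h = "\<lambda>s. t * g s"
    have h: "sq_integrable ?h" by (rule sq_integrable_scale[OF g])
    have "0 \<le> S2_inner (\<lambda>s. f s - ?h s) (\<lambda>s. f s - ?h s)" by (rule S2_inner_self_nonneg)
    also have "\<dots> = (S2_inner f f - S2_inner ?h f) - (S2_inner f ?h - S2_inner ?h ?h)"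
      by (simp only: S2_inner_diff[OF f h sq_integrable_diff[OF f h]]
        S2_inner_commute[of f "\<lambda>s. f s - ?h s"] S2_inner_commute[of ?h "\<lambda>s. f s - ?h s"]
        S2_inner_diff[OF f h f] S2_inner_diff[OF f h h])
    also have "\<dots> = S2_inner f f - 2 * t * S2_inner f g + t\<^sup>2 * S2_inner g g"
      unfolding S2_inner_scale S2_inner_scale_right S2_inner_commute[of g f] by (simp add: power2_eq_square)
    finally show ?thesis .
  qed
  show ?thesis
  proof (cases "S2_inner g g = 0")
    case True
    have "S2_inner f g = 0"
    proof (rule ccontr)
      assume nz: "S2_inner f g \<noteq> 0"
      have "S2_inner f f - 2 * ((S2_inner f f + 1) / S2_inner f g) * S2_inner f g = - S2_inner f f - 2"
        using nz by simp
      then show False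
        using expand[of "(S2_inner f f + 1) / S2_inner f g"] True S2_inner_self_nonneg[of f] by simp
    qed
    then show ?thesis using True by simp
  next
    case False
    then have pos: "S2_inner g g > 0" using S2_inner_self_nonneg[of g] by simp
    have "0 \<le> S2_inner f f - (S2_inner f g)\<^sup>2 / S2_inner g g"
      using expand[of "S2_inner f g / S2_inner g g"] False
      by (simp add: power2_eq_square divide_simps split: if_splits)
    then show ?thesis using pos by (simp add: field_simps)
  qed
qed

text \<open>The first harmonic is a constant of norm at most one on the sphere of area \<open>4 \<pi>\<close>, and its coefficient is a
multiple of the integral over \<open>A\<close>, which the Cauchy-Schwarz inequality bounds.\<close>

lemma constant_mode_le:
  assumes u: "sq_integrable u" and A: "A \<in> sets surface_measure"
    and supp: "\<And>s. s \<in> S2 - A \<Longrightarrow> u s = 0"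
  shows "(S2_inner u (harmonic 0))\<^sup>2 \<le> measure surface_measure A / (4 * pi) * S2_inner u u"
proof -
  obtain c where c: "harmonic 0 = (\<lambda>x. c)"
    using deg_le_0_const[of "harmonic 0"] deg_le_harmonic[of 0] by auto
  have "4 * pi * c\<^sup>2 \<le> 1"
    using harmonic_norm_le[of 0] by (simp add: c S2_inner_def measure_surface_S2 power2_eq_square)
  then have c1: "c\<^sup>2 \<le> 1 / (4 * pi)" by (simp add: field_simps)
  let ?i = "indicator A :: real^3 \<Rightarrow> real"
  have i2: "?i s * ?i s = ?i s" for s by (simp add: indicator_def)
  have ii: "integrable surface_measure ?i"
    using A by (simp add: less_top[symmetric])
  have i: "sq_integrable ?i"
    unfolding sq_integrable_def power2_eq_square i2 using A ii by simp
  have "S2_inner ?i ?i = measure surface_measure A"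
    unfolding S2_inner_def i2 using A sets.sets_into_space[OF A] by (simp add: Int_absorb2)
  moreover have "S2_inner u (harmonic 0) = c * S2_inner u ?i"
  proof -
    have "S2_inner u (harmonic 0) = S2_inner u (\<lambda>s. c * ?i s)"
      unfolding S2_inner_def c
      using supp by (intro Bochner_Integration.integral_cong) (auto simp: indicator_def)
    then show ?thesis by (simp add: S2_inner_scale_right)
  qed
  ultimately have "(S2_inner u (harmonic 0))\<^sup>2 \<le> c\<^sup>2 * (S2_inner u u * measure surface_measure A)"
    using S2_cauchy_schwarz[OF u i] by (simp add: power_mult_distrib mult_left_mono)
  also have "\<dots> \<le> 1 / (4 * pi) * (S2_inner u u * measure surface_measure A)"
    using c1 by (intro mult_right_mono mult_nonneg_nonneg S2_inner_self_nonneg) auto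
  finally show ?thesis by (simp add: mult_ac)
qed

section \<open>Functions vanishing on the boundary of a domain\<close>

lemma tangential_projection:
  assumes s: "s \<in> S2"
  shows "(\<Sum>k\<in>UNIV. (h \<bullet> cross3 (axis k 1) s) *\<^sub>R cross3 (axis k 1) s) = h - (h \<bullet> s) *\<^sub>R s"
proof (rule vector_eq_ldot[THEN iffD1], intro allI)
  fix w
  have ss: "s \<bullet> s = 1" using s by (simp add: dot_square_norm)
  have "w \<bullet> (\<Sum>k\<in>UNIV. (h \<bullet> cross3 (axis k 1) s) *\<^sub>R cross3 (axis k 1) s)
      = (\<Sum>k\<in>UNIV. (h \<bullet> cross3 (axis k 1) s) * (w \<bullet> cross3 (axis k 1) s))"
    by (simp add: inner_sum_right)
  also have "\<dots> = w \<bullet> (h - (h \<bullet> s) *\<^sub>R s)"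
    unfolding sum_inner_cross_axis ss by (simp add: inner_diff_right inner_commute)
  finally show "w \<bullet> (\<Sum>k\<in>UNIV. (h \<bullet> cross3 (axis k 1) s) *\<^sub>R cross3 (axis k 1) s)
      = w \<bullet> (h - (h \<bullet> s) *\<^sub>R s)" .
qed

text \<open>The intrinsic gradient constrains the derivative within the sphere only, and its rotation components are the
angular derivatives of any \<open>C\<^sup>1\<close> extension.\<close>

lemma sphere_grad_eq_angular:
  assumes F: "C1_on_S2 F" and eq: "\<And>s. s \<in> S2 \<Longrightarrow> \<phi> s = F s" and s: "s \<in> S2"
  shows "sphere_grad \<phi> s \<bullet> cross3 a s = angular a F s"
proof -
  define D where "D = frechet_derivative F (at s)"
  have D: "(F has_derivative D) (at s)"
    using F s unfolding D_def C1_on_S2_def by (simp add: frechet_derivative_works)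
  then interpret D: bounded_linear D by (rule has_derivative_bounded_linear)
  define g where "g = (\<Sum>k\<in>UNIV. D (cross3 (axis k 1) s) *\<^sub>R cross3 (axis k 1) s)"
  have ss: "s \<bullet> s = 1" using s by (simp add: dot_square_norm)
  have gh: "g \<bullet> h = D (h - (h \<bullet> s) *\<^sub>R s)" for h
    unfolding tangential_projection[OF s, symmetric] D.sum D.scaleR g_def
    by (simp add: inner_sum_right inner_commute[of _ h] mult.commute)
  \<comment> \<open>The summand vanishes on the sphere and removes the radial part of the derivative.\<close>
  define H where "H y = F y - D s / 2 * (y \<bullet> y - 1)" for y
  have "(H has_derivative (\<lambda>h. D h - D s / 2 * (s \<bullet> h + h \<bullet> s))) (at s)"
    unfolding H_def by (auto intro!: derivative_eq_intros D)
  moreover have "D h - D s / 2 * (s \<bullet> h + h \<bullet> s) = g \<bullet> h" for h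
    by (simp add: gh D.diff D.scaleR inner_commute)
  ultimately have "(H has_derivative (\<lambda>h. g \<bullet> h)) (at s within S2)"
    by (simp add: has_derivative_at_withinI)
  then have "(\<phi> has_derivative (\<lambda>h. g \<bullet> h)) (at s within S2)"
    by (rule has_derivative_transform[rotated 2]) (use s eq in \<open>auto simp: H_def dot_square_norm\<close>)
  moreover have "g \<bullet> s = 0" by (simp add: gh ss)
  ultimately have g: "has_sphere_grad \<phi> g s" by (simp add: has_sphere_grad_def)
  then have sg: "sphere_grad \<phi> s = g"
    unfolding sphere_grad_def by (rule the_equality) (rule has_sphere_grad_unique[OF s _ g])
  show "sphere_grad \<phi> s \<bullet> cross3 a s = angular a F s"
    by (simp add: sg gh angular_def D_def dot_cross_self)
qed

lemma sphere_grad_zero_outside: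
  assumes K: "closed K" and zero: "\<And>s. s \<in> S2 - K \<Longrightarrow> \<phi> s = 0" and s: "s \<in> S2 - K"
  shows "sphere_grad \<phi> s = 0"
proof -
  obtain d where d: "d > 0" "ball s d \<subseteq> - K"
    using K s open_contains_ball[of "- K"] by (auto simp: closed_def)
  have "((\<lambda>_. 0) has_derivative (\<lambda>h. 0 \<bullet> h)) (at s within S2)" by simp
  then have "(\<phi> has_derivative (\<lambda>h. 0 \<bullet> h)) (at s within S2)"
    by (rule has_derivative_transform_within[OF _ d(1)])
      (use s d zero in \<open>auto simp: subset_iff dist_commute\<close>)
  then have "has_sphere_grad \<phi> 0 s" by (simp add: has_sphere_grad_def)
  then show ?thesis
    unfolding sphere_grad_def using s has_sphere_grad_unique[of s \<phi>] by (intro the_equality) blast+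
qed

text \<open>A test function is replaced by an extension to which the integration by parts applies. The vanishing of
its angular derivatives outside \<open>\<Omega>\<close> allows integrals over \<open>\<Omega>\<close> to be taken over the sphere.\<close>

lemma test_function_extension:
  assumes "(\<phi> :: real^3 \<Rightarrow> real) \<in> test_functions \<Omega>"
  obtains F where "C1_on_S2 F" "\<And>s. s \<in> S2 \<Longrightarrow> \<phi> s = F s"
    "\<And>s. s \<in> S2 - \<Omega> \<Longrightarrow> F s = 0" "\<And>s a. s \<in> S2 - \<Omega> \<Longrightarrow> angular a F s = 0"
proof -
  obtain K U F where K: "compact K" "K \<subseteq> \<Omega>" "\<forall>s\<in>S2 - K. \<phi> s = 0"
    and U: "open U" "S2 \<subseteq> U" "\<forall>k. Ck_on k U F" "\<forall>s\<in>S2. F s = \<phi> s"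
    using assms unfolding test_functions_def smooth_on_S2_def by blast
  from U(3) have "Ck_on (Suc 0) U F" by blast
  then have F: "C1_on_S2 F"
    using U(2) unfolding C1_on_S2_def by (auto intro: continuous_on_subset)
  have eq: "\<phi> s = F s" if "s \<in> S2" for s using U(4) that by simp
  have "angular a F s = 0" if "s \<in> S2 - \<Omega>" for a s
  proof -
    have "sphere_grad \<phi> s = 0"
      using K that by (intro sphere_grad_zero_outside[of K]) (auto dest: compact_imp_closed)
    then show ?thesis
      using sphere_grad_eq_angular[OF F eq, of s a] that by simp
  qed
  moreover have "F s = 0" if "s \<in> S2 - \<Omega>" for s
    using K(2,3) eq that by (metis DiffD1 DiffD2 DiffI subsetD)
  ultimately show ?thesis using that[OF F eq] by blast
qed

abbreviation extend :: "(real^3) set \<Rightarrow> (real^3 \<Rightarrow> 'b::real_vector) \<Rightarrow> real^3 \<Rightarrow> 'b" where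
  "extend \<Omega> f s \<equiv> indicator \<Omega> s *\<^sub>R f s"

lemma sq_integrable_nn:
  assumes "f \<in> borel_measurable surface_measure"
    and "(\<integral>\<^sup>+ s. ennreal ((f s)\<^sup>2) \<partial>surface_measure) < \<infinity>"
  shows "sq_integrable f"
  unfolding sq_integrable_def integrable_iff_bounded using assms by simp

lemma S2_inner_self_nn:
  assumes "sq_integrable f"
  shows "ennreal (S2_inner f f) = (\<integral>\<^sup>+ s. ennreal ((f s)\<^sup>2) \<partial>surface_measure)"
  using assms unfolding sq_integrable_def S2_inner_def
  by (simp add: nn_integral_eq_integral power2_eq_square)

context
  fixes \<Omega> :: "(real^3) set"
  assumes \<Omega>: "\<Omega> \<in> sets surface_measure"
begin

lemma domain_Int_space: "\<Omega> \<inter> space surface_measure \<in> sets surface_measure"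
  using \<Omega> by (intro sets.Int sets.top)

lemma L2_sq_extend:
  fixes f :: "real^3 \<Rightarrow> 'b::real_normed_vector"
  shows "L2_sq \<Omega> f = (\<integral>\<^sup>+ s. ennreal ((norm (extend \<Omega> f s))\<^sup>2) \<partial>surface_measure)"
  unfolding L2_sq_def nn_integral_restrict_space[OF domain_Int_space]
  by (intro nn_integral_cong) (simp add: indicator_def)

lemma L2_extend_measurable:
  fixes f :: "real^3 \<Rightarrow> 'b::{real_normed_vector, second_countable_topology}"
  assumes "f \<in> L2 \<Omega>"
  shows "extend \<Omega> f \<in> borel_measurable surface_measure"
  using assms borel_measurable_restrict_space_iff[OF domain_Int_space, of f]
  by (simp add: L2_def)

lemma L2_sq_integrable:
  fixes f :: "real^3 \<Rightarrow> real"
  assumes "f \<in> L2 \<Omega>"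
  shows "sq_integrable (extend \<Omega> f)"
  using L2_extend_measurable[OF assms] assms
  by (intro sq_integrable_nn) (simp_all add: L2_def L2_sq_extend)

abbreviation tangential_component :: "(real^3 \<Rightarrow> real^3) \<Rightarrow> 3 \<Rightarrow> real^3 \<Rightarrow> real" where
  "tangential_component G k s \<equiv> extend \<Omega> G s \<bullet> cross3 (axis k 1) s"

lemma sum_tangential_components_le:
  assumes s: "s \<in> S2"
  shows "(\<Sum>k\<in>UNIV. (v \<bullet> cross3 (axis k 1) s)\<^sup>2) \<le> (norm v)\<^sup>2"
proof -
  have "s \<bullet> s = 1" using s by (simp add: dot_square_norm)
  then show ?thesis
    using sum_inner_cross_axis[of v s v] by (simp add: power2_eq_square dot_square_norm[unfolded power2_eq_square])
qed

lemma tangential_component_measurable: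
  assumes "G \<in> L2 \<Omega>"
  shows "tangential_component G k \<in> borel_measurable surface_measure"
  by (intro borel_measurable_inner L2_extend_measurable assms
      surface_measurable_continuous continuous_on_cross3)

lemma tangential_component_nn_le:
  "(\<Sum>k\<in>UNIV. ennreal ((tangential_component G k s)\<^sup>2)) \<le> ennreal ((norm (extend \<Omega> G s))\<^sup>2)"
  if "s \<in> S2"
  using sum_tangential_components_le[OF that, of "extend \<Omega> G s"]
  by (subst sum_ennreal) (auto intro: ennreal_leI)

lemma tangential_component_sq_integrable:
  assumes G: "G \<in> L2 \<Omega>"
  shows "sq_integrable (tangential_component G k)"
proof (rule sq_integrable_nn[OF tangential_component_measurable[OF G]])
  have "(\<integral>\<^sup>+ s. ennreal ((tangential_component G k s)\<^sup>2) \<partial>surface_measure) \<le> L2_sq \<Omega> G"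
    unfolding L2_sq_extend
  proof (rule nn_integral_mono)
    fix s assume "s \<in> space surface_measure"
    then have s: "s \<in> S2" by simp
    have "ennreal ((tangential_component G k s)\<^sup>2) \<le> (\<Sum>k\<in>UNIV. ennreal ((tangential_component G k s)\<^sup>2))"
      by (rule member_le_sum) auto
    then show "ennreal ((tangential_component G k s)\<^sup>2) \<le> ennreal ((norm (extend \<Omega> G s))\<^sup>2)"
      using tangential_component_nn_le[OF s, of G] by (rule order_trans)
  qed
  then show "(\<integral>\<^sup>+ s. ennreal ((tangential_component G k s)\<^sup>2) \<partial>surface_measure) < \<infinity>"
    using G by (auto simp: L2_def intro: le_less_trans)
qed

lemma sum_S2_inner_components_le:
  assumes H: "\<And>k. sq_integrable (H k)"
    and eq: "\<And>k s. s \<in> S2 \<Longrightarrow> H k s = tangential_component G k s"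
  shows "ennreal (\<Sum>k\<in>UNIV. S2_inner (H k) (H k)) \<le> L2_sq \<Omega> G"
proof -
  have "ennreal (\<Sum>k\<in>UNIV. S2_inner (H k) (H k)) = (\<Sum>k\<in>UNIV. ennreal (S2_inner (H k) (H k)))"
    by (simp add: sum_ennreal S2_inner_self_nonneg)
  also have "\<dots> = (\<Sum>k\<in>UNIV. \<integral>\<^sup>+ s. ennreal ((H k s)\<^sup>2) \<partial>surface_measure)"
    by (simp add: S2_inner_self_nn[OF H])
  also have "\<dots> = (\<integral>\<^sup>+ s. (\<Sum>k\<in>UNIV. ennreal ((H k s)\<^sup>2)) \<partial>surface_measure)"
    using H by (intro nn_integral_sum[symmetric]) (auto simp: sq_integrable_def)
  also have "\<dots> \<le> L2_sq \<Omega> G"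
    unfolding L2_sq_extend
    by (intro nn_integral_mono) (use tangential_component_nn_le[of _ G] in \<open>simp add: eq\<close>)
  finally show ?thesis .
qed

lemma H1_0_weak_grad:
  assumes "\<psi> \<in> H1_0 \<Omega>"
  shows "\<psi> \<in> L2 \<Omega>" "weak_grad \<Omega> \<psi> \<in> L2 \<Omega>"
proof -
  have ex: "\<exists>G. G \<in> L2 \<Omega> \<and> has_weak_grad \<Omega> \<psi> G" and "\<psi> \<in> L2 \<Omega>"
    using assms by (auto simp: H1_0_def H1_def)
  then show "\<psi> \<in> L2 \<Omega>" by simp
  show "weak_grad \<Omega> \<psi> \<in> L2 \<Omega>"
    unfolding weak_grad_def using someI_ex[OF ex] by simp
qed

lemma H1_0_approximation:
  assumes \<psi>: "\<psi> \<in> H1_0 \<Omega>" and \<epsilon>: "\<epsilon> > 0"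
  obtains F where "C1_on_S2 F"
    "S2_inner (\<lambda>s. extend \<Omega> \<psi> s - F s) (\<lambda>s. extend \<Omega> \<psi> s - F s) < \<epsilon>"
    "\<And>k. S2_inner (\<lambda>s. tangential_component (weak_grad \<Omega> \<psi>) k s - angular (axis k 1) F s)
        (\<lambda>s. tangential_component (weak_grad \<Omega> \<psi>) k s - angular (axis k 1) F s) < \<epsilon>"
proof -
  let ?G = "weak_grad \<Omega> \<psi>"
  note L2 = H1_0_weak_grad[OF \<psi>]
  obtain \<phi> where \<phi>: "\<phi> \<in> test_functions \<Omega>"
    "L2_sq \<Omega> (\<lambda>s. \<psi> s - \<phi> s) + L2_sq \<Omega> (\<lambda>s. ?G s - sphere_grad \<phi> s) < ennreal \<epsilon>"
    using \<psi> \<epsilon> unfolding H1_0_def by (auto dest!: spec[of _ "ennreal \<epsilon>"])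
  obtain F where F: "C1_on_S2 F" "\<And>s. s \<in> S2 \<Longrightarrow> \<phi> s = F s"
    "\<And>s. s \<in> S2 - \<Omega> \<Longrightarrow> F s = 0" "\<And>s a. s \<in> S2 - \<Omega> \<Longrightarrow> angular a F s = 0"
    using test_function_extension[OF \<phi>(1)] by blast
  let ?d = "\<lambda>s. extend \<Omega> \<psi> s - F s"
  let ?H = "\<lambda>k s. tangential_component ?G k s - angular (axis k 1) F s"
  have d: "sq_integrable ?d"
    by (intro sq_integrable_diff L2_sq_integrable L2 sq_integrable_continuous C1_on_S2_continuous F)
  have H: "sq_integrable (?H k)" for k
    by (intro sq_integrable_diff tangential_component_sq_integrable L2 sq_integrable_continuous
        C1_on_S2_angular_continuous F)
  have "ennreal (S2_inner ?d ?d) = L2_sq \<Omega> (\<lambda>s. \<psi> s - \<phi> s)"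
    unfolding S2_inner_self_nn[OF d] L2_sq_extend
    using F(2,3) by (intro nn_integral_cong) (auto simp: indicator_def)
  also have "\<dots> < ennreal \<epsilon>"
    using \<phi>(2) by (rule le_less_trans[rotated]) simp
  finally have 1: "S2_inner ?d ?d < \<epsilon>"
    using \<epsilon> by (simp add: ennreal_less_iff S2_inner_self_nonneg)
  have "?H k s = tangential_component (\<lambda>s. ?G s - sphere_grad \<phi> s) k s" if "s \<in> S2" for k s
    using F(4)[of s] sphere_grad_eq_angular[OF F(1,2) that, of "axis k 1"] that
    by (cases "s \<in> \<Omega>") (simp_all add: inner_diff_left)
  from sum_S2_inner_components_le[of ?H, OF H this]
  have "ennreal (\<Sum>k\<in>UNIV. S2_inner (?H k) (?H k)) \<le> L2_sq \<Omega> (\<lambda>s. ?G s - sphere_grad \<phi> s)" by blast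
  also have "\<dots> < ennreal \<epsilon>"
    using \<phi>(2) by (rule le_less_trans[rotated]) simp
  finally have 2: "(\<Sum>k\<in>UNIV. S2_inner (?H k) (?H k)) < \<epsilon>"
    using \<epsilon> by (simp add: ennreal_less_iff sum_nonneg S2_inner_self_nonneg)
  have "S2_inner (?H k) (?H k) \<le> (\<Sum>k\<in>UNIV. S2_inner (?H k) (?H k))" for k
    by (rule member_le_sum) (auto simp: S2_inner_self_nonneg)
  then have "S2_inner (?H k) (?H k) < \<epsilon>" for k using 2 by (rule le_less_trans)
  with F(1) 1 show ?thesis using that by blast
qed

text \<open>Both sides are continuous in the \<open>H\<^sup>1\<close> norm, and for test functions the formula is the integration by parts on
the sphere. The polynomial does not vanish on the boundary of \<open>\<Omega>\<close>, so the definition of the weak gradient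
alone would not give it.\<close>

lemma H1_0_green:
  assumes \<psi>: "\<psi> \<in> H1_0 \<Omega>" and p: "deg_le n p"
  shows "(\<Sum>k\<in>UNIV. S2_inner (tangential_component (weak_grad \<Omega> \<psi>) k) (angular (axis k 1) p))
    = - S2_inner (extend \<Omega> \<psi>) (spherical_laplacian p)"
proof -
  let ?u = "extend \<Omega> \<psi>" and ?G = "tangential_component (weak_grad \<Omega> \<psi>)"
  let ?T = "\<lambda>k. angular (axis k 1) p" and ?L = "spherical_laplacian p"
  note L2 = H1_0_weak_grad[OF \<psi>]
  have u: "sq_integrable ?u" and G: "sq_integrable (?G k)" for k
    using L2_sq_integrable[OF L2(1)] tangential_component_sq_integrable[OF L2(2)] by auto
  have T: "sq_integrable (?T k)" for k
    by (rule sq_integrable_continuous[OF deg_le_continuous[OF deg_le_angular[OF p]]])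
  have L: "sq_integrable ?L"
    by (rule sq_integrable_continuous[OF deg_le_continuous[OF deg_le_laplacian[OF p]]])
  define D where "D = (\<Sum>k\<in>UNIV. S2_inner (?G k) (?T k)) + S2_inner ?u ?L"
  define C where "C = (\<Sum>k\<in>UNIV. sqrt (S2_inner (?T k) (?T k))) + sqrt (S2_inner ?L ?L)"
  have C0: "C \<ge> 0" by (simp add: C_def sum_nonneg S2_inner_self_nonneg)
  have cs: "\<bar>S2_inner f g\<bar> \<le> e * sqrt (S2_inner g g)"
    if "sq_integrable f" "sq_integrable g" "S2_inner f f < e\<^sup>2" "e > 0" for f g e
  proof -
    have "\<bar>S2_inner f g\<bar> \<le> sqrt (S2_inner f f * S2_inner g g)"
      using S2_cauchy_schwarz[OF that(1,2)] by (intro real_le_rsqrt) simp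
    also have "\<dots> \<le> sqrt (e\<^sup>2 * S2_inner g g)"
      using that(3) by (intro real_sqrt_le_mono mult_right_mono S2_inner_self_nonneg) simp
    finally show ?thesis using that(4) by (simp add: real_sqrt_mult)
  qed
  have D_le: "\<bar>D\<bar> \<le> e * C" if e: "e > 0" for e
  proof -
    obtain F where F: "C1_on_S2 F" "S2_inner (\<lambda>s. ?u s - F s) (\<lambda>s. ?u s - F s) < e\<^sup>2"
      "\<And>k. S2_inner (\<lambda>s. ?G k s - angular (axis k 1) F s) (\<lambda>s. ?G k s - angular (axis k 1) F s) < e\<^sup>2"
      using H1_0_approximation[OF \<psi>, of "e\<^sup>2"] e by auto
    have Fs: "sq_integrable F" and Fa: "sq_integrable (angular (axis k 1) F)" for k
      using F(1) by (auto intro: sq_integrable_continuous C1_on_S2_continuous C1_on_S2_angular_continuous)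
    have "(\<Sum>k\<in>UNIV. S2_inner (angular (axis k 1) F) (?T k)) + S2_inner F ?L = 0"
      using laplacian_green[OF p F(1)] by (simp add: S2_inner_commute)
    then have "\<bar>D\<bar> = \<bar>(\<Sum>k\<in>UNIV. S2_inner (\<lambda>s. ?G k s - angular (axis k 1) F s) (?T k))
        + S2_inner (\<lambda>s. ?u s - F s) ?L\<bar>"
      unfolding S2_inner_diff[OF G Fa T] S2_inner_diff[OF u Fs L] D_def by (simp add: sum_subtractf)
    also have "\<dots> \<le> (\<Sum>k\<in>UNIV. \<bar>S2_inner (\<lambda>s. ?G k s - angular (axis k 1) F s) (?T k)\<bar>)
        + \<bar>S2_inner (\<lambda>s. ?u s - F s) ?L\<bar>"
      by (rule order_trans[OF abs_triangle_ineq add_right_mono[OF sum_abs]])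
    also have "\<dots> \<le> (\<Sum>k\<in>UNIV. e * sqrt (S2_inner (?T k) (?T k))) + e * sqrt (S2_inner ?L ?L)"
      by (intro add_mono sum_mono cs sq_integrable_diff G Fa T u Fs L F(2,3) e)
    finally show ?thesis by (simp add: C_def distrib_left sum_distrib_left)
  qed
  have "\<bar>D\<bar> \<le> 0"
  proof (rule field_le_epsilon)
    fix e :: real assume e: "e > 0"
    \<comment> \<open>Adding one keeps the divisor positive when \<open>C = 0\<close>.\<close>
    have "\<bar>D\<bar> \<le> e / (C + 1) * C"
      using e C0 by (intro D_le) simp
    also have "\<dots> \<le> e" using e C0 by (simp add: field_simps)
    finally show "\<bar>D\<bar> \<le> 0 + e" by simp
  qed
  then show ?thesis by (simp add: D_def)
qed

lemma H1_0_spectral_tails: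
  assumes \<psi>: "\<psi> \<in> H1_0 \<Omega>"
  shows "(\<Sum>n=1..M. 2 * real n * (S2_inner (extend \<Omega> \<psi>) (extend \<Omega> \<psi>)
      - (\<Sum>i<n\<^sup>2. (S2_inner (extend \<Omega> \<psi>) (harmonic i))\<^sup>2)))
    \<le> (\<Sum>k\<in>UNIV. S2_inner (tangential_component (weak_grad \<Omega> \<psi>) k) (tangential_component (weak_grad \<Omega> \<psi>) k))"
proof (rule weighted_spectral_tails_le)
  note L2 = H1_0_weak_grad[OF \<psi>]
  have u: "sq_integrable (extend \<Omega> \<psi>)" by (rule L2_sq_integrable[OF L2(1)])
  show "(\<Sum>i<m. eigenvalue i * (S2_inner (extend \<Omega> \<psi>) (harmonic i))\<^sup>2)
    \<le> (\<Sum>k\<in>UNIV. S2_inner (tangential_component (weak_grad \<Omega> \<psi>) k) (tangential_component (weak_grad \<Omega> \<psi>) k))" for m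
    by (intro gradient_bessel u tangential_component_sq_integrable L2 H1_0_green[OF \<psi> deg_le_harmonic])
  show "(\<lambda>m. \<Sum>i<m. (S2_inner (extend \<Omega> \<psi>) (harmonic i))\<^sup>2) \<longlonglongrightarrow> S2_inner (extend \<Omega> \<psi>) (extend \<Omega> \<psi>)"
  proof (rule S2_parseval[OF u])
    fix \<epsilon> :: real assume "\<epsilon> > 0"
    then obtain F where "C1_on_S2 F"
      "S2_inner (\<lambda>s. extend \<Omega> \<psi> s - F s) (\<lambda>s. extend \<Omega> \<psi> s - F s) < \<epsilon>"
      by (rule H1_0_approximation[OF \<psi>])
    then show "\<exists>\<phi>. continuous_on S2 \<phi> \<and> S2_inner (\<lambda>s. extend \<Omega> \<psi> s - \<phi> s) (\<lambda>s. extend \<Omega> \<psi> s - \<phi> s) < \<epsilon>"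
      using C1_on_S2_continuous by blast
  qed
qed

text \<open>The first spectral tail together with the bound for the constant mode is the inequality
\<open>2 (1 - |\<Omega>| / (4 \<pi>)) \<le> \<parallel>\<nabla>\<psi>\<^sub>j\<parallel>\<^sup>2\<close>. Summed over \<open>j\<close> it bounds \<open>N\<close> by the energy, which replaces the term \<open>N / \<pi>\<close>
of the inequality on the sphere.\<close>

lemma lieb_thirring_domain:
  assumes area: "measure surface_measure \<Omega> < 4 * pi"
    and \<psi>: "\<And>j. j \<in> {1..N} \<Longrightarrow> \<psi> j \<in> H1_0 \<Omega>" and orth: "orthonormal_family \<Omega> N \<psi>"
  shows "(\<integral>\<^sup>+ s. ennreal ((rho N \<psi> s)\<^sup>2) \<partial>surface_on \<Omega>)
    \<le> ennreal (2 / pi * ((4 * pi + measure surface_measure \<Omega>) / (4 * pi - measure surface_measure \<Omega>)))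
      * (\<Sum>j=1..N. L2_sq \<Omega> (weak_grad \<Omega> (\<psi> j)))"
proof -
  define A where "A = measure surface_measure \<Omega>"
  define C where "C = 2 / pi * ((4 * pi + A) / (4 * pi - A))"
  have A: "0 \<le> A" "A < 4 * pi" using area by (auto simp: A_def)
  define u where "u j = extend \<Omega> (\<psi> j)" for j
  define T where "T j = (\<Sum>k\<in>UNIV. S2_inner (tangential_component (weak_grad \<Omega> (\<psi> j)) k)
      (tangential_component (weak_grad \<Omega> (\<psi> j)) k))" for j
  have u: "sq_integrable (u j)" if "j \<in> {1..N}" for j
    unfolding u_def by (rule L2_sq_integrable[OF H1_0_weak_grad(1)[OF \<psi>[OF that]]])
  have on: "S2_inner (u i) (u j) = (if i = j then 1 else 0)" if "i \<in> {1..N}" "j \<in> {1..N}" for i j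
  proof -
    have "S2_inner (u i) (u j) = (\<integral>s. \<psi> i s * \<psi> j s \<partial>surface_on \<Omega>)"
      unfolding S2_inner_def u_def integral_restrict_space[OF domain_Int_space]
      by (intro Bochner_Integration.integral_cong) (auto simp: indicator_def)
    then show ?thesis using orth that by (simp add: orthonormal_family_def)
  qed
  have tails: "(\<Sum>n=1..M. 2 * real n * (1 - (\<Sum>i<n\<^sup>2. (S2_inner (u j) (harmonic i))\<^sup>2))) \<le> T j"
    if "j \<in> {1..N}" for j M
    using H1_0_spectral_tails[OF \<psi>[OF that], of M] on[OF that that] by (simp add: u_def T_def)
  have poincare: "2 * (1 - A / (4 * pi)) \<le> T j" if j: "j \<in> {1..N}" for j
  proof -
    have "(S2_inner (u j) (harmonic 0))\<^sup>2 \<le> A / (4 * pi)"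
      using constant_mode_le[OF u[OF j] \<Omega>] on[OF j j] by (simp add: A_def u_def)
    moreover have "2 * (1 - (S2_inner (u j) (harmonic 0))\<^sup>2) \<le> T j"
      using tails[OF j, of 1] by simp
    ultimately show ?thesis by simp
  qed
  have C0: "C \<ge> 0" using A by (simp add: C_def)
  have T0: "T j \<ge> 0" for j by (simp add: T_def sum_nonneg S2_inner_self_nonneg)
  have "(\<integral>\<^sup>+ s. ennreal ((rho N \<psi> s)\<^sup>2) \<partial>surface_on \<Omega>)
      = (\<integral>\<^sup>+ s. ennreal ((\<Sum>j\<in>{1..N}. (u j s)\<^sup>2)\<^sup>2) \<partial>surface_measure)"
    unfolding nn_integral_restrict_space[OF domain_Int_space]
    by (intro nn_integral_cong) (simp add: indicator_def rho_def u_def)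
  also have "\<dots> \<le> ennreal (real (card {1..N}) / pi + 3 / (2 * pi) * (\<Sum>j\<in>{1..N}. T j))"
    by (rule lieb_thirring_sphere[OF u finite_atLeastAtMost on tails])
  also have "\<dots> \<le> ennreal (C * (\<Sum>j\<in>{1..N}. T j))"
  proof (rule ennreal_leI)
    have "real N * (2 * (1 - A / (4 * pi))) \<le> (\<Sum>j\<in>{1..N}. T j)"
      using sum_mono[of "{1..N}" "\<lambda>_. 2 * (1 - A / (4 * pi))" T] poincare by simp
    moreover define S where "S = (\<Sum>j\<in>{1..N}. T j)"
    ultimately have "real N * (4 * pi - A) \<le> 2 * pi * S"
      by (simp add: field_simps)
    then have "real N \<le> 2 * pi * S / (4 * pi - A)"
      using A by (simp add: field_simps)
    then have "real N / pi \<le> 2 * S / (4 * pi - A)"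
      by (simp add: field_simps)
    moreover have "S \<ge> 0" using T0 by (simp add: S_def sum_nonneg)
    have "2 / (4 * pi - A) + 3 / (2 * pi) \<le> C"
    proof -
      have "2 / (4 * pi - A) + 3 / (2 * pi) = (16 * pi - 3 * A) / (2 * pi * (4 * pi - A))"
        using A by (simp add: divide_simps)
      also have "\<dots> \<le> (16 * pi + 4 * A) / (2 * pi * (4 * pi - A))"
        using A by (intro divide_right_mono) auto
      also have "\<dots> = C"
        using A by (simp add: C_def divide_simps) (simp add: algebra_simps)
      finally show ?thesis .
    qed
    then have "2 * S / (4 * pi - A) + 3 / (2 * pi) * S \<le> C * S"
      using mult_right_mono[OF _ \<open>S \<ge> 0\<close>] by (fastforce simp: distrib_right)
    ultimately show "real (card {1..N}) / pi + 3 / (2 * pi) * (\<Sum>j\<in>{1..N}. T j) \<le> C * (\<Sum>j\<in>{1..N}. T j)"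
      by (simp add: S_def)
  qed
  also have "\<dots> = ennreal C * (\<Sum>j\<in>{1..N}. ennreal (T j))"
    using C0 T0 by (simp add: ennreal_mult sum_nonneg)
  also have "\<dots> \<le> ennreal C * (\<Sum>j=1..N. L2_sq \<Omega> (weak_grad \<Omega> (\<psi> j)))"
  proof (intro mult_left_mono sum_mono)
    fix j assume j: "j \<in> {1..N}"
    show "ennreal (T j) \<le> L2_sq \<Omega> (weak_grad \<Omega> (\<psi> j))"
      unfolding T_def
      by (rule sum_S2_inner_components_le[OF tangential_component_sq_integrable[OF H1_0_weak_grad(2)[OF \<psi>[OF j]]]]) simp
  qed simp
  finally show ?thesis by (simp add: C_def A_def)
qed

end

lemma sphere_domain_measurable:
  assumes "sphere_domain \<Omega>"
  shows "\<Omega> \<in> sets surface_measure"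
proof -
  obtain U where "open U" "\<Omega> = S2 \<inter> U"
    using assms unfolding sphere_domain_def openin_open by blast
  then show ?thesis by (auto simp: sets_restrict_space)
qed

theorem theorem2p3:
  fixes \<Omega> :: "(real^3) set"
  assumes "sphere_domain \<Omega>"
    and "measure surface_measure \<Omega> < 4 * pi"
  shows "(\<forall>N\<ge>1. \<forall>\<psi> :: nat \<Rightarrow> real^3 \<Rightarrow> real.
            (\<forall>j\<in>{1..N}. \<psi> j \<in> H1_0 \<Omega>) \<and> orthonormal_family \<Omega> N \<psi> \<longrightarrow>
            (\<integral>\<^sup>+ s. ennreal ((rho N \<psi> s)\<^sup>2) \<partial>surface_on \<Omega>)
              \<le> best_constant \<Omega> * (\<Sum>j=1..N. L2_sq \<Omega> (weak_grad \<Omega> (\<psi> j))))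
       \<and> best_constant \<Omega> \<le>
            ennreal (2 / pi * ((4 * pi + measure surface_measure \<Omega>)
                               / (4 * pi - measure surface_measure \<Omega>)))"
proof -
  let ?C = "ennreal (2 / pi * ((4 * pi + measure surface_measure \<Omega>) / (4 * pi - measure surface_measure \<Omega>)))"
  note \<Omega> = sphere_domain_measurable[OF assms(1)]
  have C: "admissible_constant \<Omega> ?C"
    unfolding admissible_constant_def
    by (intro allI impI) (rule lieb_thirring_domain[OF \<Omega> assms(2)]; blast)
  have "(\<integral>\<^sup>+ s. ennreal ((rho N \<psi> s)\<^sup>2) \<partial>surface_on \<Omega>)
      \<le> best_constant \<Omega> * (\<Sum>j=1..N. L2_sq \<Omega> (weak_grad \<Omega> (\<psi> j)))" (is "?X \<le> _ * ?Y")
    if N: "N \<ge> 1" and \<psi>: "(\<forall>j\<in>{1..N}. \<psi> j \<in> H1_0 \<Omega>) \<and> orthonormal_family \<Omega> N \<psi>" for N \<psi>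
  proof -
    have le: "?X \<le> k * ?Y" if "admissible_constant \<Omega> k" for k
      using that N \<psi> unfolding admissible_constant_def by blast
    have "L2_sq \<Omega> (weak_grad \<Omega> (\<psi> j)) < \<infinity>" if "j \<in> {1..N}" for j
      using H1_0_weak_grad(2)[OF \<Omega>, of "\<psi> j"] \<psi> that by (simp add: L2_def)
    then have Y: "?Y \<noteq> top" by (auto simp: less_top)
    \<comment> \<open>Division by the energy lets the inequality pass to the infimum; at zero energy a finite admissible constant gives zero.\<close>
    show ?thesis
    proof (cases "?Y = 0")
      case True
      then show ?thesis using le[OF C] by simp
    next
      case False
      then have pos: "?Y > 0" by (simp add: zero_less_iff_neq_zero)
      have "?X / ?Y \<le> best_constant \<Omega>"
        unfolding best_constant_def using divide_le_posI_ennreal[OF pos] le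
        by (intro Inf_greatest) (auto simp: mult.commute)
      then have "?X / ?Y * ?Y \<le> best_constant \<Omega> * ?Y" by (rule mult_right_mono) simp
      moreover have "?X / ?Y * ?Y = ?X"
        using Y False by (simp add: ennreal_divide_times ennreal_times_divide[symmetric] ennreal_divide_self less_top)
      ultimately show ?thesis by simp
    qed
  qed
  moreover have "best_constant \<Omega> \<le> ?C"
    unfolding best_constant_def using C by (intro Inf_lower) simp
  ultimately show ?thesis by blast
qed

end
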